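(* Let $\beta\in\mathfrak{t}$ be such that $\mathcal{S}_\beta\neq\emptyset$, and let $Z_\beta^{ss}=Z_\beta\cap\mathcal{S}_\beta$ and $Y_\beta^{ss}=Y_\beta\cap\mathcal{S}_\beta$. Then: (i) $Z_\beta^{ss}$ is the set of $H_\beta$-semistable vectors in $Z_\beta$. (ii) $Y_\beta^{ss}$ is the set of $H_\beta$-semistable vectors in $W_\beta$.
   Context: Let $n\ge 1$ and let $V_n=\Lambda^2(\mathbb{R}^n)^*\otimes\mathbb{R}^n$ be the vector space of skew-symmetric bilinear maps $\mu:\mathbb{R}^n\times\mathbb{R}^n\to\mathbb{R}^n$, with the action of $\mathrm{GL}_n(\mathbb{R})$ given by $(g.\mu)(X,Y)=g\mu(g^{-1}X,g^{-1}Y)$. Let $e_1,\dots,e_n$ be the canonical basis of $\mathbb{R}^n$. For $i<j$ and any $k$, let $v_{ijk}\in V_n$ be defined by $v_{ijk}(e_i,e_j)=-v_{ijk}(e_j,e_i)=e_k$ and zero on all other pairs of basis vectors; these form a basis of $V_n$, and one writes $\mu=\sum_{i<j,\,k}\mu_{ij}^kv_{ijk}$. On $\mathfrak{gl}_n(\mathbb{R})$ use $\langle\alpha,\beta\rangle=\operatorname{tr}(\alpha\beta^t)$ and the associated norm. Let $\mathfrak{t}$ be the space of real diagonal $n\times n$ matrices, and put $\alpha_{ij}^k=E_{kk}-E_{ii}-E_{jj}\in\mathfrak{t}$, where $E_{rs}$ is the matrix with only nonzero entry $1$ in position $rs$. For nonzero $\mu\in V_n$, $\beta_\mu\in\mathfrak{t}$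 is the unique vector of minimal norm in the convex hull of $\{\alpha_{ij}^k:\mu_{ij}^k\neq0\}$. For $\beta\in\mathfrak{t}$ define $$\mathcal{S}_\beta=\{\mu\in V_n\smallsetminus\{0\}:\beta\text{ is an element of maximal norm in }\{\beta_{g.\mu}:g\in\mathrm{GL}_n(\mathbb{R})\}\},$$ $$W_\beta=\{\mu\in V_n:\langle\beta,\alpha_{ij}^k\rangle\ge\|\beta\|^2\ \ \forall\,\mu_{ij}^k\neq0\},\qquad Z_\beta=\{\mu\in V_n:\langle\beta,\alpha_{ij}^k\rangle=\|\beta\|^2\ \ \forall\,\mu_{ij}^k\neq0\},$$ $$Y_\beta=\{\mu\in W_\beta:\langle\beta,\alpha_{ij}^k\rangle=\|\beta\|^2\text{ for at least one }\mu_{ij}^k\neq0\}.$$ Let $\mathfrak{g}_\beta=\{\alpha\in\mathfrak{gl}_n(\mathbb{R}):[\alpha,\beta]=0\}$, let $\mathfrak{h}_\beta$ be the orthogonal complement of $\beta$ in $\mathfrak{g}_\beta$, and let $H_\beta$ be the connected Lie subgroup of $\mathrm{GL}_n(\mathbb{R})$ with Lie algebra $\mathfrak{h}_\beta$. A vector $\mu\in V_n$ is called $H_\beta$-semistable if $0\notin\overline{H_\beta.\mu}$. *)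

theory Defs
  imports "HOL-Analysis.Analysis"
begin

text \<open>
  The space \<open>\<real>\<^sup>n\<close> is \<open>real^'n\<close>. The index type carries a linear order so that the
  condition \<open>i < j\<close> makes sense. Bilinear maps \<open>\<mu>\<close> are elements of
  \<open>real^'n \<Rightarrow>\<^sub>L real^'n \<Rightarrow>\<^sub>L real^'n\<close>: in finite dimension every bilinear map is of this form,
  and the operator norm induces the usual topology.
\<close>

type_synonym 'n matr = "real^'n^'n"
type_synonym 'n bilin = "(real^'n) \<Rightarrow>\<^sub>L (real^'n) \<Rightarrow>\<^sub>L (real^'n)"

definition bilin :: "(real^'n \<Rightarrow> real^'n \<Rightarrow> real^'n) \<Rightarrow> 'n::finite bilin" where
  "bilin f = Blinfun (\<lambda>X. Blinfun (\<lambda>Y. f X Y))"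

lemma bilin_apply [simp]:
  fixes f :: "real^'n::finite \<Rightarrow> real^'n \<Rightarrow> real^'n"
  assumes "bilinear f"
  shows "bilin f X Y = f X Y"
proof -
  have bb: "bounded_bilinear f"
    using assms by (simp add: bilinear_conv_bounded_bilinear)
  have in1: "blinfun_apply (Blinfun (f X)) = f X" for X
    using bounded_bilinear.bounded_linear_right[OF bb] by (rule bounded_linear_Blinfun_apply)
  obtain K where K: "\<And>a b. norm (f a b) \<le> norm a * norm b * K" and "0 \<le> K"
    using bounded_bilinear.nonneg_bounded[OF bb] by blast
  have "bounded_linear (\<lambda>X. Blinfun (f X))"
  proof (rule bounded_linear_intro)
    show "Blinfun (f (x + y)) = Blinfun (f x) + Blinfun (f y)" for x y
      by (rule blinfun_eqI) (simp add: in1 blinfun.add_left bounded_bilinear.add_left[OF bb])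
    show "Blinfun (f (r *\<^sub>R x)) = r *\<^sub>R Blinfun (f x)" for r x
      by (rule blinfun_eqI) (simp add: in1 blinfun.scaleR_left bounded_bilinear.scaleR_left[OF bb])
    show "norm (Blinfun (f x)) \<le> norm x * K" for x
    proof (rule norm_blinfun_bound)
      show "0 \<le> norm x * K" using \<open>0 \<le> K\<close> by simp
      show "norm (blinfun_apply (Blinfun (f x)) y) \<le> norm x * K * norm y" for y
        using K[of x y] by (simp add: in1 mult_ac)
    qed
  qed
  then show ?thesis
    by (simp add: bilin_def bounded_linear_Blinfun_apply in1)
qed

definition V :: "'n::finite bilin set" where
  "V = {\<mu> :: 'n bilin. \<forall>X Y. \<mu> X Y = - \<mu> Y X}"

definition GL :: "'n::finite matr set" where
  "GL = {g. invertible g}"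

definition act :: "'n::finite matr \<Rightarrow> 'n bilin \<Rightarrow> 'n bilin" where
  "act g \<mu> = bilin (\<lambda>X Y. g *v \<mu> (matrix_inv g *v X) (matrix_inv g *v Y))"

lemma act_apply:
  "act g \<mu> X Y = g *v \<mu> (matrix_inv g *v X) (matrix_inv g *v Y)"
  unfolding act_def
  by (rule bilin_apply)
    (auto simp: bilinear_def blinfun.add_left blinfun.add_right blinfun.scaleR_left
      blinfun.scaleR_right matrix_vector_right_distrib matrix_vector_mult_scaleR intro!: linearI)

definition basis_vec :: "'n \<Rightarrow> 'n \<Rightarrow> 'n \<Rightarrow> 'n::finite bilin" where
  "basis_vec i j k = bilin (\<lambda>X Y. (X $ i * Y $ j - X $ j * Y $ i) *\<^sub>R axis k 1)"

definition coef :: "'n::finite bilin \<Rightarrow> 'n \<Rightarrow> 'n \<Rightarrow> 'n \<Rightarrow> real" where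
  "coef \<mu> i j k = \<mu> (axis i 1) (axis j 1) $ k"

lemma basis_vec_apply:
  "basis_vec i j k X Y = (X $ i * Y $ j - X $ j * Y $ i) *\<^sub>R axis k 1"
  unfolding basis_vec_def
  by (rule bilin_apply)
    (auto simp: bilinear_def algebra_simps intro!: linearI)

lemma coef_expansion:
  fixes \<mu> :: "'n::{finite,linorder} bilin"
  assumes "\<mu> \<in> V"
  shows "\<mu> = (\<Sum>(i, j)\<in>{(i, j). i < j}. \<Sum>k\<in>UNIV. coef \<mu> i j k *\<^sub>R basis_vec i j k)"
    (is "\<mu> = ?R")
proof (rule blinfun_eqI, rule blinfun_eqI)
  fix X Y
  have sk: "coef \<mu> i j k = - coef \<mu> j i k" for i j k
    using assms unfolding V_def coef_def by (metis (mono_tags, lifting) mem_Collect_eq vector_uminus_component)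
  show "\<mu> X Y = ?R X Y"
  proof (subst vec_eq_iff, rule allI)
    fix k
    let ?c = "\<lambda>i j. coef \<mu> i j k * (X $ i * Y $ j)"
    let ?L = "{(i, j). i < j} :: ('n \<times> 'n) set"
    let ?G = "{(i, j). j < i} :: ('n \<times> 'n) set"
    let ?D = "{(i, j). i = j} :: ('n \<times> 'n) set"
    have "\<mu> X Y = \<mu> (\<Sum>i\<in>UNIV. X $ i *\<^sub>R axis i 1) (\<Sum>j\<in>UNIV. Y $ j *\<^sub>R axis j 1)"
      by (metis (no_types, lifting) basis_expansion scalar_mult_eq_scaleR sum.cong)
    also have "\<dots> = (\<Sum>i\<in>UNIV. \<Sum>j\<in>UNIV. (X $ i * Y $ j) *\<^sub>R \<mu> (axis i 1) (axis j 1))"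
      by (simp add: blinfun.sum_left blinfun.sum_right blinfun.scaleR_left blinfun.scaleR_right
          scaleR_sum_right) (subst sum.swap, simp add: mult.commute)
    finally have "\<mu> X Y $ k = (\<Sum>i\<in>UNIV. \<Sum>j\<in>UNIV. ?c i j)"
      by (simp add: coef_def mult_ac)
    also have "\<dots> = (\<Sum>(i, j)\<in>UNIV. ?c i j)"
      by (simp add: sum.cartesian_product)
    also have "(UNIV :: ('n \<times> 'n) set) = ?L \<union> (?G \<union> ?D)"
      by auto
    also have "(\<Sum>(i, j)\<in>?L \<union> (?G \<union> ?D). ?c i j)
        = (\<Sum>(i, j)\<in>?L. ?c i j) + ((\<Sum>(i, j)\<in>?G. ?c i j) + (\<Sum>(i, j)\<in>?D. ?c i j))"
      by (subst sum.union_disjoint, simp, simp, force, subst sum.union_disjoint) auto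
    also have "(\<Sum>(i, j)\<in>?D. ?c i j) = 0"
    proof (rule sum.neutral, clarify)
      fix i show "?c i i = 0" using sk[of i i k] by simp
    qed
    also have "(\<Sum>(i, j)\<in>?G. ?c i j) = (\<Sum>(i, j)\<in>?L. ?c j i)"
      by (rule sum.reindex_bij_witness[where i = prod.swap and j = prod.swap]) auto
    also have "(\<Sum>(i, j)\<in>?L. ?c i j) + ((\<Sum>(i, j)\<in>?L. ?c j i) + 0)
        = (\<Sum>(i, j)\<in>?L. coef \<mu> i j k * (X $ i * Y $ j - X $ j * Y $ i))"
      unfolding add_0_right sum.distrib[symmetric]
    proof (rule sum.cong, simp, clarify)
      fix i j show "?c i j + ?c j i = coef \<mu> i j k * (X $ i * Y $ j - X $ j * Y $ i)"
        using sk[of j i k] by (simp add: algebra_simps)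
    qed
    also have "\<dots> = ?R X Y $ k"
      by (simp add: blinfun.sum_left blinfun.scaleR_left basis_vec_apply case_prod_unfold
          axis_def if_distrib cong: if_cong)
    finally show "\<mu> X Y $ k = ?R X Y $ k" .
  qed
qed

text \<open>
  The inner product and norm of the type \<open>real^'n^'n\<close> are those of \<open>\<langle>\<alpha>, \<beta>\<rangle> = tr (\<alpha> \<beta>\<^sup>t)\<close>.
\<close>

lemma inner_eq_trace: "inner A B = trace (A ** transpose B)" for A B :: "'n::finite matr"
  by (simp add: trace_def matrix_matrix_mult_def transpose_def inner_vec_def)

definition diagonal :: "'n::finite matr set" where
  "diagonal = {A. \<forall>i j. i \<noteq> j \<longrightarrow> A $ i $ j = 0}"

definition Emat :: "'n::finite \<Rightarrow> 'n \<Rightarrow> 'n matr" where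
  "Emat r s = (\<chi> i j. if i = r \<and> j = s then 1 else 0)"

definition weight :: "'n::finite \<Rightarrow> 'n \<Rightarrow> 'n \<Rightarrow> 'n matr" where
  "weight i j k = Emat k k - Emat i i - Emat j j"

definition weights :: "'n::{finite,linorder} bilin \<Rightarrow> 'n matr set" where
  "weights \<mu> = {weight i j k | i j k. i < j \<and> coef \<mu> i j k \<noteq> 0}"

definition beta_of :: "'n::{finite,linorder} bilin \<Rightarrow> 'n matr" where
  "beta_of \<mu> = (THE b. b \<in> convex hull weights \<mu> \<and> (\<forall>c \<in> convex hull weights \<mu>. norm b \<le> norm c))"

lemma beta_of_unique:
  fixes \<mu> :: "'n::{finite,linorder} bilin"
  assumes "\<mu> \<in> V" "\<mu> \<noteq> 0"
  shows "\<exists>!b. b \<in> convex hull weights \<mu> \<and> (\<forall>c \<in> convex hull weights \<mu>. norm b \<le> norm c)"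
proof -
  let ?C = "convex hull weights \<mu>"
  have "finite (weights \<mu>)"
    by (rule finite_subset[of _ "\<Union>i. \<Union>j. \<Union>k. {weight i j k}"]) (auto simp: weights_def)
  then have cl: "closed ?C"
    by (simp add: compact_imp_closed finite_imp_compact_convex_hull)
  have ne: "weights \<mu> \<noteq> {}"
  proof
    assume "weights \<mu> = {}"
    then have "coef \<mu> i j k = 0" if "i < j" for i j k
      using that by (auto simp: weights_def)
    then have "\<mu> = 0"
      by (subst coef_expansion[OF assms(1)]) (auto intro!: sum.neutral)
    then show False using assms(2) by simp
  qed
  obtain b where b: "b \<in> ?C" "\<forall>c \<in> ?C. norm b \<le> norm c"
  proof -
    have "?C \<noteq> {}" using ne by simp
    from distance_attains_inf[OF cl this, of 0] that show thesis
      unfolding dist_0_norm by metis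
  qed
  show ?thesis
  proof (rule ex1I[of _ b])
    fix c assume "c \<in> ?C \<and> (\<forall>d \<in> ?C. norm c \<le> norm d)"
    then show "c = b"
      using any_closest_point_unique[OF convex_convex_hull cl, of c b 0] b by (simp add: dist_norm)
  qed (use b in auto)
qed

definition S_beta :: "'n::{finite,linorder} matr \<Rightarrow> 'n bilin set" where
  "S_beta \<beta> = {\<mu> \<in> V - {0}. \<beta> \<in> {beta_of (act g \<mu>) | g. g \<in> GL}
      \<and> (\<forall>\<beta>' \<in> {beta_of (act g \<mu>) | g. g \<in> GL}. norm \<beta>' \<le> norm \<beta>)}"

definition W_beta :: "'n::{finite,linorder} matr \<Rightarrow> 'n bilin set" where
  "W_beta \<beta> = {\<mu> \<in> V. \<forall>i j k. i < j \<longrightarrow> coef \<mu> i j k \<noteq> 0 \<longrightarrow> inner \<beta> (weight i j k) \<ge> (norm \<beta>)\<^sup>2}"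

definition Z_beta :: "'n::{finite,linorder} matr \<Rightarrow> 'n bilin set" where
  "Z_beta \<beta> = {\<mu> \<in> V. \<forall>i j k. i < j \<longrightarrow> coef \<mu> i j k \<noteq> 0 \<longrightarrow> inner \<beta> (weight i j k) = (norm \<beta>)\<^sup>2}"

definition Y_beta :: "'n::{finite,linorder} matr \<Rightarrow> 'n bilin set" where
  "Y_beta \<beta> = {\<mu> \<in> W_beta \<beta>. \<exists>i j k. i < j \<and> coef \<mu> i j k \<noteq> 0 \<and> inner \<beta> (weight i j k) = (norm \<beta>)\<^sup>2}"

definition Zss_beta :: "'n::{finite,linorder} matr \<Rightarrow> 'n bilin set" where
  "Zss_beta \<beta> = Z_beta \<beta> \<inter> S_beta \<beta>"

definition Yss_beta :: "'n::{finite,linorder} matr \<Rightarrow> 'n bilin set" where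
  "Yss_beta \<beta> = Y_beta \<beta> \<inter> S_beta \<beta>"

text \<open>
  The multiplication \<open>*\<close> on \<open>real^'n^'n\<close> is componentwise, so the matrix exponential is written
  out with the matrix product \<open>**\<close>.
\<close>

definition mexp :: "'n::finite matr \<Rightarrow> 'n matr" where
  "mexp A = (\<Sum>m. (1 / fact m) *\<^sub>R (((**) A ^^ m) (mat 1)))"

lemma norm_matrix_mult_le: "norm (A ** B) \<le> norm A * norm B" for A B :: "'n::finite matr"
proof -
  have e: "(A ** B) $ i $ j = inner (A $ i) (transpose B $ j)" for i j
    by (simp add: matrix_matrix_mult_def inner_vec_def transpose_def)
  have "(norm (A ** B))\<^sup>2 = (\<Sum>i\<in>UNIV. \<Sum>j\<in>UNIV. ((A ** B) $ i $ j)\<^sup>2)"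
    unfolding power2_norm_eq_inner by (simp add: inner_vec_def power2_eq_square)
  also have "\<dots> \<le> (\<Sum>i\<in>UNIV. \<Sum>j\<in>UNIV. inner (A $ i) (A $ i) * inner (transpose B $ j) (transpose B $ j))"
    unfolding e by (intro sum_mono Cauchy_Schwarz_ineq)
  also have "\<dots> = (norm A)\<^sup>2 * (norm (transpose B))\<^sup>2"
    by (simp add: power2_norm_eq_inner inner_vec_def[of A] inner_vec_def[of "transpose B"] sum_product)
  also have "(norm (transpose B))\<^sup>2 = (norm B)\<^sup>2"
    unfolding power2_norm_eq_inner inner_vec_def transpose_def
    by (subst sum.swap) simp
  finally have "(norm (A ** B))\<^sup>2 \<le> (norm A * norm B)\<^sup>2"
    by (simp add: power_mult_distrib)
  then show ?thesis
    by (rule power2_le_imp_le) simp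
qed

lemma mexp_sums: "(\<lambda>m. (1 / fact m) *\<^sub>R (((**) A ^^ m) (mat 1))) sums mexp A"
  for A :: "'n::finite matr"
proof -
  have b: "norm (((**) A ^^ m) (mat 1)) \<le> norm A ^ m * norm (mat 1 :: 'n matr)" for m
  proof (induction m)
    case (Suc m)
    have "norm (((**) A ^^ Suc m) (mat 1)) \<le> norm A * norm (((**) A ^^ m) (mat 1))"
      by (simp add: norm_matrix_mult_le)
    also have "\<dots> \<le> norm A * (norm A ^ m * norm (mat 1 :: 'n matr))"
      by (intro mult_left_mono Suc) simp
    finally show ?case by (simp add: mult_ac)
  qed simp
  have "summable (\<lambda>m. (inverse (fact m) * norm A ^ m) * norm (mat 1 :: 'n matr))"
    by (intro summable_mult2 summable_exp)
  then have "summable (\<lambda>m. (1 / fact m) *\<^sub>R (((**) A ^^ m) (mat 1)))"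
    by (rule summable_comparison_test'[where N = 0])
      (use b in \<open>auto simp: divide_simps\<close>)
  then show ?thesis
    unfolding mexp_def by (rule summable_sums)
qed

text \<open>
  The connected Lie subgroup with Lie algebra \<open>\<h>\<close> is the subgroup of \<open>GL\<^sub>n\<close> generated by
  the exponentials of the elements of \<open>\<h>\<close>.
\<close>

inductive_set connected_lie_subgroup :: "'n::finite matr set \<Rightarrow> 'n matr set"
  for \<h> :: "'n matr set" where
  one: "mat 1 \<in> connected_lie_subgroup \<h>"
| exp: "A \<in> \<h> \<Longrightarrow> mexp A \<in> connected_lie_subgroup \<h>"
| mult: "g \<in> connected_lie_subgroup \<h> \<Longrightarrow> h \<in> connected_lie_subgroup \<h>
    \<Longrightarrow> g ** h \<in> connected_lie_subgroup \<h>"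
| inv: "g \<in> connected_lie_subgroup \<h> \<Longrightarrow> matrix_inv g \<in> connected_lie_subgroup \<h>"

definition g_beta :: "'n::finite matr \<Rightarrow> 'n matr set" where
  "g_beta \<beta> = {A. A ** \<beta> - \<beta> ** A = 0}"

definition h_beta :: "'n::finite matr \<Rightarrow> 'n matr set" where
  "h_beta \<beta> = {A \<in> g_beta \<beta>. inner A \<beta> = 0}"

definition H_beta :: "'n::finite matr \<Rightarrow> 'n matr set" where
  "H_beta \<beta> = connected_lie_subgroup (h_beta \<beta>)"

definition semistable :: "'n::finite matr set \<Rightarrow> 'n bilin \<Rightarrow> bool" where
  "semistable G \<mu> \<longleftrightarrow> 0 \<notin> closure {act g \<mu> | g. g \<in> G}"

end

theory Submission
  imports Defs
begin

text \<open>
  All weights have trace \<open>-1\<close>, hence so does \<open>\<beta>\<close>, and \<open>\<mu> \<in> W\<^sub>\<beta>\<close> with \<open>\<parallel>\<beta>\<^sub>\<mu>\<parallel> \<le> \<parallel>\<beta>\<parallel>\<close> forces \<open>\<beta>\<^sub>\<mu> = \<beta>\<close>. It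
  remains to compare semistability with the bound \<open>\<parallel>\<beta>\<^sub>g\<^sub>\<mu>\<parallel> \<le> \<parallel>\<beta>\<parallel>\<close> for all \<open>g\<close>.

  If \<open>\<mu> \<in> W\<^sub>\<beta>\<close> is semistable and \<open>\<gamma> = \<beta>\<^sub>g\<^sub>\<mu>\<close>, write \<open>p g q\<close> as a monomial matrix with \<open>p\<close>, \<open>q\<close> in the
  parabolic subgroups of \<open>\<gamma>\<close> and \<open>\<beta>\<close>. Then \<open>x = q\<^sup>-\<^sup>1\<mu>\<close> is still semistable and \<open>\<parallel>\<beta>\<^sub>x\<parallel> \<ge> \<parallel>\<gamma>\<parallel>\<close>;
  but a one-parameter subgroup of \<open>H\<^sub>\<beta>\<close> drives \<open>x\<close> to \<open>0\<close> as soon as \<open>\<parallel>\<beta>\<^sub>x\<parallel> > \<parallel>\<beta>\<parallel>\<close>.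

  If \<open>\<mu> \<in> W\<^sub>\<beta> \<inter> S\<^sub>\<beta>\<close>, then \<open>\<beta>\<^sub>k\<^sub>\<mu> = \<beta>\<close> for all \<open>k\<close> in the compact group \<open>K\<close> of orthogonal matrices
  commuting with \<open>\<beta>\<close>, so no diagonal \<open>A \<bottom> \<beta>\<close> is negative on all weights of \<open>k\<mu>\<close>. As \<open>K\<close> is
  compact, \<open>\<parallel>exp(A) k\<mu>\<parallel>\<close> is bounded below, and \<open>H\<^sub>\<beta> \<subseteq> K exp(A) K\<close> up to signs.
\<close>

section \<open>Coefficients and the action\<close>

lemma component_eq_sum_coef:
  fixes \<mu> :: "'n::finite bilin"
  shows "\<mu> X Y $ k = (\<Sum>i\<in>UNIV. \<Sum>j\<in>UNIV. X $ i * Y $ j * coef \<mu> i j k)"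
proof -
  have "\<mu> X Y = \<mu> (\<Sum>i\<in>UNIV. X $ i *\<^sub>R axis i 1) (\<Sum>j\<in>UNIV. Y $ j *\<^sub>R axis j 1)"
    by (metis (no_types, lifting) basis_expansion scalar_mult_eq_scaleR sum.cong)
  also have "\<dots> = (\<Sum>i\<in>UNIV. \<Sum>j\<in>UNIV. (X $ i * Y $ j) *\<^sub>R \<mu> (axis i 1) (axis j 1))"
    by (simp add: blinfun.sum_left blinfun.sum_right blinfun.scaleR_left blinfun.scaleR_right
        scaleR_sum_right) (subst sum.swap, simp add: mult.commute)
  finally show ?thesis
    by (simp add: coef_def)
qed

lemma coef_act:
  "coef (act g \<mu>) i j k = (\<Sum>c\<in>UNIV. \<Sum>a\<in>UNIV. \<Sum>b\<in>UNIV.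
     g $ k $ c * (matrix_inv g $ a $ i * matrix_inv g $ b $ j * coef \<mu> a b c))"
proof -
  have ax: "(M *v axis i 1) $ a = M $ a $ i" for M :: "'a matr" and i a
    by (simp add: matrix_vector_mult_basis column_def)
  show ?thesis
    unfolding coef_def[of "act g \<mu>"] act_apply
    by (simp add: matrix_vector_mult_def[of g] component_eq_sum_coef[of \<mu>] ax sum_distrib_left)
qed

lemma abs_coef_le_norm: "\<bar>coef \<mu> i j k\<bar> \<le> norm \<mu>"
proof -
  have "\<bar>coef \<mu> i j k\<bar> \<le> norm (\<mu> (axis i 1) (axis j 1))"
    unfolding coef_def by (rule component_le_norm_cart)
  also have "\<dots> \<le> norm (\<mu> (axis i 1)) * norm (axis j (1::real))"
    by (rule norm_blinfun)
  also have "\<dots> \<le> norm \<mu>"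
    using norm_blinfun[of \<mu> "axis i 1"] by simp
  finally show ?thesis .
qed

text \<open>With \<open>abs_coef_le_norm\<close> this makes the operator norm comparable to the l1
  norm of the coefficients, so limits and lower bounds may be checked coefficientwise.\<close>

lemma norm_le_sum_coef: "norm \<mu> \<le> (\<Sum>i\<in>UNIV. \<Sum>j\<in>UNIV. \<Sum>k\<in>UNIV. \<bar>coef \<mu> i j k\<bar>)"
proof -
  let ?S = "\<Sum>i\<in>UNIV. \<Sum>j\<in>UNIV. \<Sum>k\<in>UNIV. \<bar>coef \<mu> i j k\<bar>"
  have S0: "0 \<le> ?S" by (intro sum_nonneg) auto
  have "norm (\<mu> X Y) \<le> ?S * norm X * norm Y" for X Y
  proof -
    have "norm (\<mu> X Y) \<le> (\<Sum>k\<in>UNIV. \<bar>\<mu> X Y $ k\<bar>)"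
      by (rule norm_le_l1_cart)
    also have "\<dots> \<le> (\<Sum>k\<in>UNIV. \<Sum>i\<in>UNIV. \<Sum>j\<in>UNIV. \<bar>coef \<mu> i j k\<bar> * norm X * norm Y)"
    proof (rule sum_mono)
      fix k
      have "\<bar>\<mu> X Y $ k\<bar> \<le> (\<Sum>i\<in>UNIV. \<Sum>j\<in>UNIV. \<bar>X $ i * Y $ j * coef \<mu> i j k\<bar>)"
        unfolding component_eq_sum_coef
        by (rule order_trans[OF sum_abs]) (intro sum_mono sum_abs)
      also have "\<dots> \<le> (\<Sum>i\<in>UNIV. \<Sum>j\<in>UNIV. \<bar>coef \<mu> i j k\<bar> * norm X * norm Y)"
      proof (intro sum_mono)
        fix i j
        have "\<bar>X $ i\<bar> * \<bar>Y $ j\<bar> \<le> norm X * norm Y"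
          by (intro mult_mono component_le_norm_cart) auto
        then show "\<bar>X $ i * Y $ j * coef \<mu> i j k\<bar> \<le> \<bar>coef \<mu> i j k\<bar> * norm X * norm Y"
          using mult_left_mono[of "\<bar>X $ i\<bar> * \<bar>Y $ j\<bar>" "norm X * norm Y" "\<bar>coef \<mu> i j k\<bar>"]
          by (simp add: abs_mult mult_ac)
      qed
      finally show "\<bar>\<mu> X Y $ k\<bar> \<le> \<dots>" .
    qed
    also have "\<dots> = ?S * norm X * norm Y"
      by (subst sum.swap, subst (2) sum.swap) (simp add: sum_distrib_right)
    finally show ?thesis .
  qed
  then show ?thesis
    using S0 by (intro norm_blinfun_bound) (auto intro!: mult_nonneg_nonneg)
qed

lemma tendsto_coefI:
  fixes f :: "'a \<Rightarrow> 'n::finite bilin"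
  assumes "\<And>i j k. ((\<lambda>t. coef (f t) i j k) \<longlongrightarrow> coef l i j k) F"
  shows "(f \<longlongrightarrow> l) F"
proof -
  have d: "coef (f t - l) i j k = coef (f t) i j k - coef l i j k" for t i j k
    by (simp add: coef_def blinfun.diff_left)
  have "((\<lambda>t. \<Sum>i\<in>UNIV. \<Sum>j\<in>UNIV. \<Sum>k\<in>UNIV. \<bar>coef (f t - l) i j k\<bar>) \<longlongrightarrow>
      (\<Sum>i\<in>(UNIV::'n set). \<Sum>j\<in>(UNIV::'n set). \<Sum>k\<in>(UNIV::'n set). \<bar>0\<bar>)) F"
    unfolding d by (intro tendsto_sum tendsto_rabs) (use assms in \<open>simp add: LIM_zero_iff\<close>)
  then have "((\<lambda>t. norm (f t - l)) \<longlongrightarrow> 0) F"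
    by (intro tendsto_0_le[where K = 1 and g = "\<lambda>t. norm (f t - l)"])
      (auto intro!: always_eventually order_trans[OF norm_le_sum_coef])
  then show ?thesis
    by (simp add: LIM_zero_iff tendsto_norm_zero_iff)
qed

section \<open>Matrix inverses and the group action\<close>

lemma matrix_inv_mult:
  fixes g :: "'n::finite matr"
  assumes "invertible g"
  shows "g ** matrix_inv g = mat 1" "matrix_inv g ** g = mat 1"
  using someI_ex[OF assms[unfolded invertible_def]] by (simp_all add: matrix_inv_def)

lemma matrix_inv_unique:
  fixes g :: "'n::finite matr"
  assumes "g ** h = mat 1"
  shows "matrix_inv g = h" "invertible g"
proof -
  have hg: "h ** g = mat 1" using assms by (simp add: matrix_left_right_inverse)
  show i: "invertible g" using assms hg unfolding invertible_def by blast
  have "matrix_inv g = matrix_inv g ** (g ** h)" using assms by simp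
  also have "\<dots> = h" by (simp add: matrix_mul_assoc matrix_inv_mult[OF i])
  finally show "matrix_inv g = h" .
qed

lemma matrix_inv_matrix_mult:
  fixes g h :: "'n::finite matr"
  assumes "invertible g" "invertible h"
  shows "matrix_inv (g ** h) = matrix_inv h ** matrix_inv g"
proof (rule matrix_inv_unique)
  have "g ** h ** (matrix_inv h ** matrix_inv g) = g ** (h ** matrix_inv h) ** matrix_inv g"
    by (simp add: matrix_mul_assoc)
  then show "g ** h ** (matrix_inv h ** matrix_inv g) = mat 1"
    using assms by (simp add: matrix_inv_mult)
qed

lemma act_mult:
  fixes g h :: "'n::finite matr"
  assumes "invertible g" "invertible h"
  shows "act (g ** h) \<mu> = act g (act h \<mu>)"
  by (intro blinfun_eqI)
    (simp add: act_apply matrix_inv_matrix_mult[OF assms] matrix_vector_mul_assoc)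

lemma act_one [simp]: "act (mat 1) \<mu> = \<mu>"
proof -
  have "matrix_inv (mat 1 :: 'a matr) = mat 1" by (rule matrix_inv_unique) simp
  then show ?thesis by (intro blinfun_eqI) (simp add: act_apply)
qed

lemma act_zero [simp]: "act g 0 = 0"
  by (intro blinfun_eqI) (simp add: act_apply)

lemma act_in_V: "\<mu> \<in> V \<Longrightarrow> act g \<mu> \<in> V"
  unfolding V_def act_apply mem_Collect_eq
  by (metis (no_types, lifting) matrix_vector_mult_diff_distrib diff_0 matrix_vector_mult_0_right)

lemma coef_swap: "\<mu> \<in> V \<Longrightarrow> coef \<mu> j i k = - coef \<mu> i j k"
  unfolding V_def coef_def by (metis (mono_tags, lifting) mem_Collect_eq vector_uminus_component)

text \<open>The outer factor costs K and each of the two arguments costs L. Used with operator norms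
  for general g and with K = L = 1 for orthogonal g.\<close>

lemma norm_act_le:
  fixes g :: "'n::finite matr"
  assumes "\<And>x. norm (g *v x) \<le> K * norm x" "\<And>x. norm (matrix_inv g *v x) \<le> L * norm x"
    and "0 \<le> K" "0 \<le> L"
  shows "norm (act g \<mu>) \<le> K * L\<^sup>2 * norm \<mu>"
proof -
  have "norm (act g \<mu> X Y) \<le> K * L\<^sup>2 * norm \<mu> * norm X * norm Y" for X Y
  proof -
    let ?X = "matrix_inv g *v X" and ?Y = "matrix_inv g *v Y"
    have "norm (act g \<mu> X Y) \<le> K * norm (\<mu> ?X ?Y)"
      unfolding act_apply by (rule assms)
    also have "\<dots> \<le> K * (norm \<mu> * norm ?X * norm ?Y)"
      by (intro mult_left_mono assms order_trans[OF norm_blinfun] mult_right_mono norm_blinfun) auto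
    also have "\<dots> \<le> K * (norm \<mu> * (L * norm X) * (L * norm Y))"
      by (intro mult_left_mono mult_mono assms) (auto simp: assms)
    finally show ?thesis by (simp add: power2_eq_square mult_ac)
  qed
  then show ?thesis
    using assms(3,4) by (intro norm_blinfun_bound) (auto intro!: mult_nonneg_nonneg)
qed

lemma norm_act_bounded:
  fixes g :: "'n::finite matr"
  shows "\<exists>C>0. \<forall>\<mu>. norm (act g \<mu>) \<le> C * norm \<mu>"
proof -
  have b: "bounded_linear ((*v) A)" for A :: "'n matr" by simp
  let ?K = "onorm ((*v) g)" and ?L = "onorm ((*v) (matrix_inv g))"
  have "norm (act g \<mu>) \<le> ?K * ?L\<^sup>2 * norm \<mu>" for \<mu>
    by (rule norm_act_le) (use onorm[OF b] onorm_pos_le[OF b] in auto)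
  then have "norm (act g \<mu>) \<le> (?K * ?L\<^sup>2 + 1) * norm \<mu>" for \<mu>
    by (rule order_trans) (simp add: mult_right_mono)
  moreover have "0 < ?K * ?L\<^sup>2 + 1"
    using mult_nonneg_nonneg[OF onorm_pos_le[OF b] zero_le_power2, of g ?L] by linarith
  ultimately show ?thesis by blast
qed

lemma orthogonal_matrix_inv:
  fixes g :: "'n::finite matr"
  assumes "orthogonal_matrix g"
  shows "matrix_inv g = transpose g" "invertible g"
  using assms unfolding orthogonal_matrix_def by (auto intro: matrix_inv_unique)

lemma norm_orthogonal_mult:
  fixes g :: "'n::finite matr"
  assumes "orthogonal_matrix g"
  shows "norm (g *v x) = norm x"
  using orthogonal_transformation_norm[of "(*v) g"] assms
  by (simp add: orthogonal_transformation_matrix)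

lemma norm_act_orthogonal:
  fixes g :: "'n::finite matr"
  assumes g: "orthogonal_matrix g"
  shows "norm (act g \<mu>) = norm \<mu>"
proof -
  have le: "norm (act h \<nu>) \<le> norm \<nu>" if "orthogonal_matrix h" for h :: "'n matr" and \<nu>
    using norm_act_le[of h 1 1 \<nu>] that
    by (simp add: norm_orthogonal_mult orthogonal_matrix_inv del: transpose_matrix_vector)
  have t: "orthogonal_matrix (transpose g)" using g by simp
  have "norm \<mu> = norm (act (transpose g) (act g \<mu>))"
    using g t by (simp add: act_mult[symmetric] orthogonal_matrix_inv) (simp add: orthogonal_matrix_def)
  then show ?thesis using le[OF g, of \<mu>] le[OF t, of "act g \<mu>"] by simp
qed

text \<open>A uniform positive lower bound on the orbit is the form of semistability that passes to
  limits of orbit points.\<close>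

lemma semistable_iff:
  "semistable G \<mu> \<longleftrightarrow> (\<exists>c>0. \<forall>g\<in>G. c \<le> norm (act g \<mu>))"
proof -
  have "(0 \<in> closure {act g \<mu> | g. g \<in> G}) \<longleftrightarrow> (\<forall>e>0. \<exists>g\<in>G. norm (act g \<mu>) < e)"
    unfolding closure_approachable by (simp add: dist_norm) blast
  then show ?thesis unfolding semistable_def by (meson not_less)
qed

section \<open>Weights\<close>

lemma inner_Emat: "inner A (Emat r s) = A $ r $ s"
proof -
  have "inner A (Emat r s) = (\<Sum>i\<in>UNIV. \<Sum>j\<in>UNIV. if j = s then if i = r then A $ i $ j else 0 else 0)"
    unfolding inner_vec_def Emat_def by (intro sum.cong refl) simp
  then show ?thesis by simp
qed

lemma inner_weight: "inner A (weight i j k) = A $ k $ k - A $ i $ i - A $ j $ j"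
  by (simp add: weight_def inner_diff_right inner_Emat)

lemma weight_commute: "weight j i k = weight i j k"
  by (simp add: weight_def)

lemma coef_neq_0_sorted:
  fixes \<mu> :: "'n::{finite,linorder} bilin"
  assumes "\<mu> \<in> V" "coef \<mu> i j k \<noteq> 0"
  obtains i' j' where "i' < j'" "coef \<mu> i' j' k \<noteq> 0" "weight i' j' k = weight i j k"
proof -
  have "i \<noteq> j" using coef_swap[OF assms(1), of i i k] assms(2) by auto
  then consider "i < j" | "j < i" by fastforce
  then show thesis
  proof cases
    case 2
    then show ?thesis
      using that[of j i] coef_swap[OF assms(1), of i j k] assms(2) by (simp add: weight_commute)
  qed (use that assms(2) in blast)
qed

lemma weights_eq:
  fixes \<mu> :: "'n::{finite,linorder} bilin"
  assumes "\<mu> \<in> V"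
  shows "weights \<mu> = {weight i j k | i j k. coef \<mu> i j k \<noteq> 0}"
proof
  show "{weight i j k | i j k. coef \<mu> i j k \<noteq> 0} \<subseteq> weights \<mu>"
  proof clarify
    fix i j k assume "coef \<mu> i j k \<noteq> 0"
    then obtain i' j' where "i' < j'" "coef \<mu> i' j' k \<noteq> 0" "weight i' j' k = weight i j k"
      by (rule coef_neq_0_sorted[OF assms])
    then show "weight i j k \<in> weights \<mu>" unfolding weights_def by (metis (mono_tags, lifting) mem_Collect_eq)
  qed
qed (auto simp: weights_def)

lemma W_beta_iff:
  "\<mu> \<in> W_beta \<beta> \<longleftrightarrow> \<mu> \<in> V \<and>
    (\<forall>i j k. coef \<mu> i j k \<noteq> 0 \<longrightarrow> (norm \<beta>)\<^sup>2 \<le> inner \<beta> (weight i j k))"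
proof -
  have "(norm \<beta>)\<^sup>2 \<le> inner \<beta> (weight i j k)" if \<mu>: "\<mu> \<in> W_beta \<beta>" "coef \<mu> i j k \<noteq> 0" for i j k
  proof -
    have "\<mu> \<in> V" using \<mu>(1) by (simp add: W_beta_def)
    then obtain i' j' where "i' < j'" "coef \<mu> i' j' k \<noteq> 0" "weight i' j' k = weight i j k"
      using \<mu>(2) by (rule coef_neq_0_sorted)
    then show ?thesis
      using \<mu>(1) unfolding W_beta_def mem_Collect_eq by metis
  qed
  then show ?thesis by (auto simp: W_beta_def)
qed

lemma Z_beta_subset_W_beta: "Z_beta \<beta> \<subseteq> W_beta \<beta>"
  by (auto simp: Z_beta_def W_beta_def)

lemma inner_hull_weights_ge:
  fixes \<mu> :: "'n::{finite,linorder} bilin"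
  assumes "\<mu> \<in> V" "\<And>i j k. coef \<mu> i j k \<noteq> 0 \<Longrightarrow> r \<le> inner \<gamma> (weight i j k)"
    and "x \<in> convex hull weights \<mu>"
  shows "r \<le> inner \<gamma> x"
proof -
  have "convex hull weights \<mu> \<subseteq> {x. inner \<gamma> x \<ge> r}"
    by (rule hull_minimal) (auto simp: weights_eq[OF assms(1)] convex_halfspace_ge assms(2))
  then show ?thesis using assms(3) by auto
qed

lemma hull_weights_diagonal:
  fixes \<mu> :: "'n::{finite,linorder} bilin"
  assumes "x \<in> convex hull weights \<mu>"
  shows "x \<in> diagonal"
proof -
  have "subspace (diagonal :: 'n matr set)"
    unfolding diagonal_def by (auto simp: subspace_def)
  then have "convex hull weights \<mu> \<subseteq> diagonal"
    by (intro hull_minimal subspace_imp_convex)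
      (auto simp: weights_def weight_def Emat_def diagonal_def)
  then show ?thesis using assms by auto
qed

text \<open>Every weight has trace 1 - 1 - 1, even if indices coincide; the half-space bound for I
  and for -I carries the equality to the hull.\<close>

lemma trace_hull_weights:
  fixes \<mu> :: "'n::{finite,linorder} bilin"
  assumes "\<mu> \<in> V" "x \<in> convex hull weights \<mu>"
  shows "inner (mat 1) x = - 1"
proof -
  have "inner (mat 1) (weight i j k) = - 1" for i j k :: 'n
    by (simp add: inner_weight mat_def)
  then show ?thesis
    using inner_hull_weights_ge[OF assms(1) _ assms(2), of "-1" "mat 1"]
      inner_hull_weights_ge[OF assms(1) _ assms(2), of 1 "- mat 1"]
    by (intro antisym) simp_all
qed

section \<open>The point of the weight hull closest to the origin\<close>

lemma beta_of_closest:
  fixes \<mu> :: "'n::{finite,linorder} bilin"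
  assumes "\<mu> \<in> V" "\<mu> \<noteq> 0"
  shows beta_of_in_hull: "beta_of \<mu> \<in> convex hull weights \<mu>"
    and norm_beta_of_le: "c \<in> convex hull weights \<mu> \<Longrightarrow> norm (beta_of \<mu>) \<le> norm c"
  using theI'[OF beta_of_unique[OF assms]] unfolding beta_of_def by auto

text \<open>Variational inequality for the closest point: the hull lies beyond the hyperplane
  through \<open>beta_of \<mu>\<close> orthogonal to it. In other words, \<mu> lies in
  \<open>W_beta (beta_of \<mu>)\<close>.\<close>

lemma inner_beta_of_ge:
  fixes \<mu> :: "'n::{finite,linorder} bilin"
  assumes "\<mu> \<in> V" "coef \<mu> i j k \<noteq> 0"
  shows "(norm (beta_of \<mu>))\<^sup>2 \<le> inner (beta_of \<mu>) (weight i j k)"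
proof -
  have ne: "\<mu> \<noteq> 0" using assms(2) by (auto simp: coef_def)
  let ?C = "convex hull weights \<mu>"
  have "finite (weights \<mu>)"
    by (rule finite_subset[of _ "\<Union>i. \<Union>j. \<Union>k. {weight i j k}"]) (auto simp: weights_def)
  then have cl: "closed ?C"
    by (simp add: compact_imp_closed finite_imp_compact_convex_hull)
  have "weight i j k \<in> ?C"
    using assms by (intro hull_inc) (auto simp: weights_eq)
  then have "inner (0 - beta_of \<mu>) (weight i j k - beta_of \<mu>) \<le> 0"
    using beta_of_closest[OF assms(1) ne]
    by (intro any_closest_point_dot[OF convex_convex_hull cl]) (auto simp: dist_norm)
  then show ?thesis
    by (simp add: inner_diff_right power2_norm_eq_inner)
qed

text \<open>The hull lies in the half-space cut out by \<gamma>, whose distance from 0 is the norm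
  of \<gamma>.\<close>

lemma norm_le_norm_beta_of:
  fixes \<mu> :: "'n::{finite,linorder} bilin"
  assumes "\<mu> \<in> V" "\<mu> \<noteq> 0"
    and "\<And>i j k. coef \<mu> i j k \<noteq> 0 \<Longrightarrow> (norm \<gamma>)\<^sup>2 \<le> inner \<gamma> (weight i j k)"
  shows "norm \<gamma> \<le> norm (beta_of \<mu>)"
proof -
  have "(norm \<gamma>)\<^sup>2 \<le> inner \<gamma> (beta_of \<mu>)"
    by (rule inner_hull_weights_ge[OF assms(1,3) beta_of_in_hull[OF assms(1,2)]])
  also have "\<dots> \<le> norm \<gamma> * norm (beta_of \<mu>)" by (rule norm_cauchy_schwarz)
  finally show ?thesis
    by (cases "\<gamma> = 0") (auto simp: power2_eq_square)
qed

text \<open>The inner product of \<beta> with \<open>beta_of \<mu>\<close> is at least the square of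
  either norm, so the expanded square of the difference is at most 0.\<close>

lemma beta_of_eqI:
  fixes \<mu> :: "'n::{finite,linorder} bilin"
  assumes "\<mu> \<in> W_beta \<beta>" "\<mu> \<noteq> 0" "norm (beta_of \<mu>) \<le> norm \<beta>"
  shows "beta_of \<mu> = \<beta>"
proof -
  have "(norm \<beta>)\<^sup>2 \<le> inner \<beta> (beta_of \<mu>)"
    using assms(1,2) by (intro inner_hull_weights_ge[OF _ _ beta_of_in_hull]) (auto simp: W_beta_iff)
  moreover have "(norm (beta_of \<mu>))\<^sup>2 \<le> (norm \<beta>)\<^sup>2"
    using assms(3) by (intro power_mono) auto
  ultimately have "(norm (beta_of \<mu> - \<beta>))\<^sup>2 \<le> 0"
    by (simp add: power2_norm_eq_inner inner_diff_left inner_diff_right inner_commute)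
  then show ?thesis by simp
qed

text \<open>If every weight lay strictly beyond the hyperplane of \<beta>, so would the hull, and
  with it \<beta> itself, which lies on that hyperplane.\<close>

lemma Y_betaI:
  fixes \<mu> :: "'n::{finite,linorder} bilin"
  assumes "\<mu> \<in> W_beta \<beta>" "\<mu> \<noteq> 0" "beta_of \<mu> = \<beta>"
  shows "\<mu> \<in> Y_beta \<beta>"
proof (rule ccontr)
  assume "\<mu> \<notin> Y_beta \<beta>"
  then have "weights \<mu> \<subseteq> {x. inner \<beta> x > (norm \<beta>)\<^sup>2}"
    using assms(1) by (fastforce simp: Y_beta_def W_beta_def weights_def)
  then have "convex hull weights \<mu> \<subseteq> {x. inner \<beta> x > (norm \<beta>)\<^sup>2}"
    by (rule hull_minimal) (rule convex_halfspace_gt)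
  moreover have "\<beta> \<in> convex hull weights \<mu>"
    using beta_of_in_hull[of \<mu>] assms by (auto simp: W_beta_iff)
  ultimately show False by (auto simp: power2_norm_eq_inner)
qed

lemma trace_eq_if_S_beta_nonempty:
  fixes \<beta> :: "'n::{finite,linorder} matr"
  assumes "S_beta \<beta> \<noteq> {}"
  shows "inner (mat 1) \<beta> = - 1"
proof -
  obtain \<mu> g where \<mu>: "\<mu> \<in> V" "\<mu> \<noteq> 0" "g \<in> GL" "\<beta> = beta_of (act g \<mu>)"
    using assms by (auto simp: S_beta_def)
  \<comment> \<open>\<open>beta_of\<close> is known to lie in the hull only for nonzero
    arguments.\<close>
  have "act g \<mu> \<noteq> 0"
  proof
    assume "act g \<mu> = 0"
    then have "act (matrix_inv g) (act g \<mu>) = 0" by simp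
    moreover have "invertible (matrix_inv g)"
      using matrix_inv_unique(2)[OF matrix_inv_mult(2)] \<mu>(3) by (auto simp: GL_def)
    ultimately show False
      using \<mu> by (simp add: act_mult[symmetric] GL_def matrix_inv_mult)
  qed
  then show ?thesis
    using trace_hull_weights[OF act_in_V beta_of_in_hull[OF act_in_V]] \<mu> by metis
qed

section \<open>Diagonal matrices and the exponential\<close>

definition diag_mat :: "('n \<Rightarrow> real) \<Rightarrow> 'n::finite matr" where
  "diag_mat a = (\<chi> i j. if i = j then a i else 0)"

lemma diag_mat_nth [simp]: "diag_mat a $ i $ j = (if i = j then a i else 0)"
  by (simp add: diag_mat_def)

lemma diagonal_eq_diag_mat: "A \<in> diagonal \<Longrightarrow> A = diag_mat (\<lambda>i. A $ i $ i)"
  by (auto simp: diagonal_def vec_eq_iff)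

lemma mat_1_eq_diag_mat: "mat 1 = diag_mat (\<lambda>i. 1)"
  by (simp add: vec_eq_iff mat_def)

lemma diag_mat_mult_left: "(diag_mat a ** A) $ i $ j = a i * A $ i $ j"
  by (simp add: matrix_matrix_mult_def if_distrib[where f = "\<lambda>x. x * _"] cong: if_cong)

lemma diag_mat_mult_right: "(A ** diag_mat a) $ i $ j = A $ i $ j * a j"
  by (simp add: matrix_matrix_mult_def if_distrib[where f = "\<lambda>x. _ * x"] cong: if_cong)

lemma diag_mat_mult: "diag_mat a ** diag_mat b = diag_mat (\<lambda>i. a i * b i)"
  by (simp add: vec_eq_iff diag_mat_mult_left)

lemma inner_diag_mat_right: "inner A (diag_mat b) = (\<Sum>i\<in>UNIV. A $ i $ i * b i)"
  by (simp add: inner_vec_def if_distrib cong: if_cong)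

lemma commute_diag_mat_iff:
  "A ** diag_mat b = diag_mat b ** A \<longleftrightarrow> (\<forall>i j. A $ i $ j \<noteq> 0 \<longrightarrow> b i = b j)"
  unfolding vec_eq_iff diag_mat_mult_left diag_mat_mult_right
  by (metis mult.commute mult_cancel_left)

text \<open>The \<open>basis_vec i j k\<close> are weight vectors of the diagonal torus: for entries
  exp(A i) the factor is the exponential of the pairing of A with
  \<open>weight i j k\<close>.\<close>

lemma coef_act_diag_mat:
  assumes "\<And>i. a i \<noteq> 0"
  shows "coef (act (diag_mat a) \<mu>) i j k = a k / (a i * a j) * coef \<mu> i j k"
proof -
  have "matrix_inv (diag_mat a) = diag_mat (\<lambda>i. 1 / a i)"
    by (rule matrix_inv_unique) (simp add: diag_mat_mult assms mat_1_eq_diag_mat)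
  moreover have "diag_mat c *v axis l 1 = c l *\<^sub>R axis l 1" for c :: "'a \<Rightarrow> real" and l
    by (simp add: matrix_vector_mult_basis column_def) (simp add: vec_eq_iff axis_def)
  moreover have "(diag_mat a *v y) $ k = a k * y $ k" for y
    by (simp add: matrix_vector_mult_def if_distrib[where f = "\<lambda>x. x * _"] cong: if_cong)
  ultimately show ?thesis
    by (simp add: coef_def act_apply blinfun.scaleR_left blinfun.scaleR_right)
qed

section \<open>The matrix exponential\<close>

lemma linear_sums_matr:
  fixes F :: "'n::finite matr \<Rightarrow> 'n matr"
  assumes "linear F" "f sums s"
  shows "(\<lambda>m. F (f m)) sums F s"
  using assms bounded_linear.sums linear_conv_bounded_linear by blast

lemma linear_matrix_mult:
  fixes g h :: "'n::finite matr"
  shows "linear (\<lambda>X. g ** X ** h)"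
  by (rule linearI)
    (simp_all add: vec_eq_iff matrix_matrix_mult_def algebra_simps sum.distrib sum_distrib_left sum_distrib_right)

text \<open>The relation passes to all powers and through the series. B = A gives commutation, B = g
  A g^-1 gives conjugation of exponentials.\<close>

lemma mexp_intertwine:
  fixes g :: "'n::finite matr"
  assumes "g ** A = B ** g"
  shows "g ** mexp A = mexp B ** g"
proof -
  have p: "g ** (((**) A ^^ m) (mat 1)) = (((**) B ^^ m) (mat 1)) ** g" for m
    by (induction m) (simp_all add: matrix_mul_assoc assms, metis assms matrix_mul_assoc)
  have sc: "X ** (c *\<^sub>R Y) = c *\<^sub>R (X ** Y)" "(c *\<^sub>R X) ** Y = c *\<^sub>R (X ** Y)" for c and X Y :: "'n matr"
    by (simp_all add: vec_eq_iff matrix_matrix_mult_def sum_distrib_left mult_ac)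
  show ?thesis
    using sums_unique2[OF linear_sums_matr[OF linear_matrix_mult[of g "mat 1"] mexp_sums[of A]],
        of "mexp B ** g"]
      linear_sums_matr[OF linear_matrix_mult[of "mat 1" g] mexp_sums[of B]]
    by (simp add: sc p)
qed

lemma mexp_diag_mat: "mexp (diag_mat a) = diag_mat (\<lambda>i. exp (a i))"
proof -
  have p: "((**) (diag_mat a) ^^ m) (mat 1) = diag_mat (\<lambda>i. a i ^ m)" for m
    by (induction m) (simp_all add: mat_1_eq_diag_mat diag_mat_mult)
  have "mexp (diag_mat a) $ i $ j = diag_mat (\<lambda>i. exp (a i)) $ i $ j" for i j
  proof -
    have "(\<lambda>m. ((1 / fact m) *\<^sub>R diag_mat (\<lambda>i. a i ^ m)) $ i $ j) sums mexp (diag_mat a) $ i $ j"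
      using bounded_linear.sums[OF bounded_linear_vec_nth
          bounded_linear.sums[OF bounded_linear_vec_nth mexp_sums[of "diag_mat a"]]]
      unfolding p .
    moreover have "(\<lambda>m. ((1 / fact m) *\<^sub>R diag_mat (\<lambda>i. a i ^ m)) $ i $ j) sums
        diag_mat (\<lambda>i. exp (a i)) $ i $ j"
      using exp_converges[of "a i"] by (auto simp: divide_inverse mult_ac)
    ultimately show ?thesis by (rule sums_unique2)
  qed
  then show ?thesis by (simp add: vec_eq_iff)
qed

section \<open>Block determinants\<close>

text \<open>Jacobi's formula. The product rule gives one determinant per row i, with that row
  replaced by row i of \<open>B ** \<Psi> s\<close>; expanded in the rows of
  \<open>\<Psi> s\<close>, only the i-th term avoids a repeated row.\<close>

lemma has_field_derivative_det:
  fixes \<Psi> :: "real \<Rightarrow> 'n::finite matr"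
  assumes "\<And>i j. ((\<lambda>t. \<Psi> t $ i $ j) has_field_derivative (B ** \<Psi> s) $ i $ j) (at s)"
  shows "((\<lambda>t. det (\<Psi> t)) has_field_derivative trace B * det (\<Psi> s)) (at s)"
proof -
  let ?M = "\<lambda>i. \<chi> a. if a = i then \<Sum>j\<in>UNIV. B $ i $ j *s \<Psi> s $ j else \<Psi> s $ a"
  have M: "det (?M i) = B $ i $ i * det (\<Psi> s)" for i
  proof -
    have "det (?M i) = (\<Sum>j\<in>UNIV. B $ i $ j * det (\<chi> a. if a = i then \<Psi> s $ j else \<Psi> s $ a))"
      by (simp add: det_linear_row_sum det_row_mul)
    also have "\<dots> = (\<Sum>j\<in>UNIV. if j = i then B $ i $ i * det (\<Psi> s) else 0)"
    proof (rule sum.cong[OF refl])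
      fix j
      show "B $ i $ j * det (\<chi> a. if a = i then \<Psi> s $ j else \<Psi> s $ a)
          = (if j = i then B $ i $ i * det (\<Psi> s) else 0)"
      proof (cases "j = i")
        case True
        then have "(\<chi> a. if a = i then \<Psi> s $ j else \<Psi> s $ a) = \<Psi> s"
          by (simp add: vec_eq_iff)
        then show ?thesis using True by simp
      next
        case False
        then have "det (\<chi> a. if a = i then \<Psi> s $ j else \<Psi> s $ a) = 0"
          by (intro det_identical_rows[of i j]) (auto simp: row_def)
        then show ?thesis using False by simp
      qed
    qed
    finally show ?thesis by simp
  qed
  have Mrow: "(\<Sum>j\<in>UNIV. B $ i $ j *s \<Psi> s $ j) $ k = (B ** \<Psi> s) $ i $ k" for i k
    by (simp add: matrix_matrix_mult_def)
  have "((\<lambda>t. det (\<Psi> t)) has_field_derivative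
      (\<Sum>p | p permutes UNIV. of_int (sign p) *
        (\<Sum>i\<in>UNIV. (B ** \<Psi> s) $ i $ p i * (\<Prod>l\<in>UNIV - {i}. \<Psi> s $ l $ p l)))) (at s)"
    unfolding det_def by (intro DERIV_sum DERIV_cmult has_field_derivative_prod assms)
  also have "(\<Sum>p | p permutes UNIV. of_int (sign p) *
      (\<Sum>i\<in>UNIV. (B ** \<Psi> s) $ i $ p i * (\<Prod>l\<in>UNIV - {i}. \<Psi> s $ l $ p l)))
      = (\<Sum>p | p permutes UNIV. of_int (sign p) * (\<Sum>i\<in>UNIV. \<Prod>l\<in>UNIV. ?M i $ l $ p l))"
  proof (intro sum.cong refl arg_cong2[where f = "(*)"])
    fix p :: "'n \<Rightarrow> 'n" and i
    have "(\<Prod>l\<in>UNIV. ?M i $ l $ p l) = ?M i $ i $ p i * (\<Prod>l\<in>UNIV - {i}. ?M i $ l $ p l)"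
      by (rule prod.remove) auto
    also have "?M i $ i $ p i = (B ** \<Psi> s) $ i $ p i"
      unfolding Mrow[symmetric] by simp
    also have "(\<Prod>l\<in>UNIV - {i}. ?M i $ l $ p l) = (\<Prod>l\<in>UNIV - {i}. \<Psi> s $ l $ p l)"
      by (rule prod.cong) auto
    finally show "(B ** \<Psi> s) $ i $ p i * (\<Prod>l\<in>UNIV - {i}. \<Psi> s $ l $ p l) = (\<Prod>l\<in>UNIV. ?M i $ l $ p l)"
      by (rule sym)
  qed
  also have "\<dots> = (\<Sum>i\<in>UNIV. det (?M i))"
    unfolding det_def sum_distrib_left by (rule sum.swap)
  also have "\<dots> = trace B * det (\<Psi> s)"
    unfolding M trace_def by (simp add: sum_distrib_right)
  finally show ?thesis .
qed

text \<open>Each entry is a power series in t, differentiated termwise: \<open>diffs\<close> brings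
  down the factor m + 1, which turns 1/(m+1)! into 1/m! and leaves one extra factor A.\<close>

lemma has_field_derivative_mexp:
  fixes A :: "'n::finite matr"
  shows "((\<lambda>t. mexp (t *\<^sub>R A) $ i $ j) has_field_derivative (A ** mexp (t *\<^sub>R A)) $ i $ j) (at t)"
proof -
  define c where "c i j m = (((**) A ^^ m) (mat 1)) $ i $ j / fact m" for i j m
  have p: "((**) (t *\<^sub>R A) ^^ m) (mat 1) = t ^ m *\<^sub>R ((**) A ^^ m) (mat 1)" for t m
  proof (induction m)
    case (Suc m)
    then show ?case
      by (simp add: vec_eq_iff matrix_matrix_mult_def sum_distrib_left mult_ac)
  qed simp
  have s: "(\<lambda>m. c i j m * t ^ m) sums mexp (t *\<^sub>R A) $ i $ j" for i j t
    using bounded_linear.sums[OF bounded_linear_vec_nth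
        bounded_linear.sums[OF bounded_linear_vec_nth mexp_sums[of "t *\<^sub>R A"]]]
    unfolding p c_def by (simp add: mult_ac)
  have e: "(\<lambda>t. mexp (t *\<^sub>R A) $ i $ j) = (\<lambda>t. \<Sum>m. c i j m * t ^ m)"
    using s by (auto simp: sums_iff)
  have d: "diffs (c i j) m = (\<Sum>k\<in>UNIV. A $ i $ k * c k j m)" for m
    by (simp add: diffs_def c_def matrix_matrix_mult_def sum_divide_distrib[symmetric] divide_simps del: of_nat_Suc)
  have "(\<lambda>m. \<Sum>k\<in>UNIV. A $ i $ k * (c k j m * t ^ m)) sums (\<Sum>k\<in>UNIV. A $ i $ k * mexp (t *\<^sub>R A) $ k $ j)"
    by (intro sums_sum sums_mult s)
  then have "(\<lambda>m. diffs (c i j) m * t ^ m) sums (A ** mexp (t *\<^sub>R A)) $ i $ j"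
    by (simp add: d matrix_matrix_mult_def sum_distrib_right mult.assoc)
  moreover have "((\<lambda>t. \<Sum>m. c i j m * t ^ m) has_field_derivative (\<Sum>m. diffs (c i j) m * t ^ m)) (at t)"
    using s by (intro termdiffs_strong_converges_everywhere) (auto simp: sums_iff)
  ultimately show ?thesis unfolding e by (simp add: sums_iff)
qed

text \<open>Identity rows outside S make the determinant the principal minor on S without changing
  the index type.\<close>

definition restrict_mat :: "'n set \<Rightarrow> 'n::finite matr \<Rightarrow> 'n matr" where
  "restrict_mat S g = (\<chi> i j. if i \<in> S then g $ i $ j else if i = j then 1 else 0)"

definition preserves :: "'n set \<Rightarrow> 'n::finite matr \<Rightarrow> bool" where
  "preserves S g \<longleftrightarrow> (\<forall>i j. g $ i $ j \<noteq> 0 \<longrightarrow> (i \<in> S \<longleftrightarrow> j \<in> S))"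

lemma mult_restrict_mat:
  assumes "preserves S g" "i \<in> S"
  shows "(g ** restrict_mat S h) $ i $ j = (g ** h) $ i $ j"
proof -
  have "g $ i $ k * restrict_mat S h $ k $ j = g $ i $ k * h $ k $ j" for k
    using assms by (cases "k \<in> S") (auto simp: preserves_def restrict_mat_def)
  then show ?thesis
    unfolding matrix_matrix_mult_def vec_lambda_beta by (intro sum.cong refl)
qed

text \<open>Rows of g in S vanish outside the columns in S, so the product only sees the rows of h
  that \<open>restrict_mat\<close> keeps.\<close>

lemma restrict_mat_mult:
  assumes "preserves S g"
  shows "restrict_mat S (g ** h) = restrict_mat S g ** restrict_mat S h"
proof -
  have "restrict_mat S (g ** h) $ i $ j = (restrict_mat S g ** restrict_mat S h) $ i $ j" for i j
  proof (cases "i \<in> S")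
    case True
    then have "(restrict_mat S g ** restrict_mat S h) $ i $ j = (g ** restrict_mat S h) $ i $ j"
      by (simp add: restrict_mat_def[of S g] matrix_matrix_mult_def)
    then show ?thesis
      using mult_restrict_mat[OF assms True] True by (simp add: restrict_mat_def[of S "g ** h"])
  next
    case False
    then show ?thesis
      by (simp add: restrict_mat_def matrix_matrix_mult_def if_distrib[where f = "\<lambda>x. x * _"] cong: if_cong)
  qed
  then show ?thesis by (simp add: vec_eq_iff)
qed

definition bdet :: "'n set \<Rightarrow> 'n::finite matr \<Rightarrow> real" where
  "bdet S g = det (restrict_mat S g)"

lemma bdet_mult: "preserves S g \<Longrightarrow> bdet S (g ** h) = bdet S g * bdet S h"
  by (simp add: bdet_def restrict_mat_mult det_mul)

lemma bdet_one [simp]: "bdet S (mat 1) = 1"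
proof -
  have "restrict_mat S (mat 1) = mat 1"
    by (simp add: vec_eq_iff restrict_mat_def mat_def)
  then show ?thesis by (simp add: bdet_def)
qed

lemma bdet_diag_mat: "bdet S (diag_mat a) = (\<Prod>i\<in>S. a i)"
proof -
  have "bdet S (diag_mat a) = (\<Prod>i\<in>UNIV. if i \<in> S then a i else 1)"
    unfolding bdet_def by (subst det_diagonal) (auto simp: restrict_mat_def intro!: prod.cong)
  then show ?thesis by (simp add: prod.If_cases)
qed

lemma abs_bdet_orthogonal:
  assumes "orthogonal_matrix k" "preserves S k"
  shows "\<bar>bdet S k\<bar> = 1"
proof -
  have "restrict_mat S (transpose k) = transpose (restrict_mat S k)"
    using assms(2) by (auto simp: vec_eq_iff restrict_mat_def transpose_def preserves_def)
  then have "bdet S k * bdet S k = bdet S (k ** transpose k)"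
    using assms(2) by (simp add: bdet_mult) (simp add: bdet_def)
  also have "\<dots> = 1" using assms(1) by (simp add: orthogonal_matrix_def)
  finally show ?thesis by (metis abs_1 abs_mult_self_eq abs_square_eq_1 power2_eq_square)
qed

text \<open>By Jacobi's formula the minor of exp(tA) solves f' = c f with f(0) = 1, where c is the
  trace of the block.\<close>

lemma bdet_mexp:
  assumes "preserves S A"
  shows "bdet S (mexp A) = exp (\<Sum>i\<in>S. A $ i $ i)"
proof -
  let ?c = "\<Sum>i\<in>S. A $ i $ i"
  define f where "f t = bdet S (mexp (t *\<^sub>R A))" for t
  have f': "(f has_field_derivative ?c * f t) (at t)" for t
  proof -
    \<comment> \<open>The rows outside S are constant in t; hence the zero rows here.\<close>
    let ?B = "\<chi> i j. if i \<in> S then A $ i $ j else 0"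
    have "trace ?B = ?c"
      by (simp add: trace_def sum.If_cases)
    moreover have "((\<lambda>t. restrict_mat S (mexp (t *\<^sub>R A)) $ i $ j) has_field_derivative
        (?B ** restrict_mat S (mexp (t *\<^sub>R A))) $ i $ j) (at t)" for i j
    proof (cases "i \<in> S")
      case True
      have "(?B ** restrict_mat S (mexp (t *\<^sub>R A))) $ i $ j = (A ** mexp (t *\<^sub>R A)) $ i $ j"
        using mult_restrict_mat[OF assms True, of "mexp (t *\<^sub>R A)" j] True
        by (simp add: matrix_matrix_mult_def)
      then show ?thesis
        using has_field_derivative_mexp[of A i j t] True by (simp add: restrict_mat_def)
    next
      case False
      then show ?thesis by (simp add: restrict_mat_def matrix_matrix_mult_def)
    qed
    ultimately show ?thesis
      using has_field_derivative_det[of "\<lambda>t. restrict_mat S (mexp (t *\<^sub>R A))" ?B t]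
      unfolding f_def bdet_def by simp
  qed
  have "((\<lambda>t. f t * exp (- (?c * t))) has_field_derivative 0) (at t)" for t
    by (rule derivative_eq_intros f' refl | simp)+
  then have "f 1 * exp (- (?c * 1)) = f 0 * exp (- (?c * 0))"
    by (intro DERIV_isconst_all) auto
  moreover have "f 0 = 1"
  proof -
    have "mexp (0 *\<^sub>R A) = mat 1"
      using mexp_diag_mat[of "\<lambda>i. 0"] by (simp add: mat_1_eq_diag_mat) (simp add: diag_mat_def zero_vec_def)
    then show ?thesis by (simp add: f_def)
  qed
  ultimately show ?thesis
    by (simp add: f_def exp_minus field_simps)
qed

lemma invertible_mexp: "invertible (mexp A)"
proof -
  have "det (mexp A) = bdet UNIV (mexp A)"
    by (simp add: bdet_def restrict_mat_def)
  also have "\<dots> \<noteq> 0"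
    by (subst bdet_mexp) (auto simp: preserves_def)
  finally show ?thesis by (simp add: invertible_det_nz)
qed

text \<open>On the centralizer of \<open>diag_mat b\<close> this is the logarithm of the character whose differential
  is the inner product with \<open>diag_mat b\<close>.\<close>

definition log_char :: "('n \<Rightarrow> real) \<Rightarrow> 'n::finite matr \<Rightarrow> real" where
  "log_char b g = (\<Sum>v\<in>range b. v * ln \<bar>bdet {i. b i = v} g\<bar>)"

lemma commute_preserves:
  assumes "g ** diag_mat b = diag_mat b ** g"
  shows "preserves {i. b i = v} g"
  using assms by (auto simp: commute_diag_mat_iff preserves_def)

lemma matrix_inv_commute:
  fixes g :: "'n::finite matr"
  assumes "invertible g" "g ** B = B ** g"
  shows "matrix_inv g ** B = B ** matrix_inv g"
proof -
  have "matrix_inv g ** B = matrix_inv g ** (B ** g) ** matrix_inv g"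
    by (simp add: matrix_mul_assoc[symmetric] matrix_inv_mult[OF assms(1)])
  also have "\<dots> = B ** matrix_inv g"
    unfolding assms(2)[symmetric] by (simp add: matrix_mul_assoc matrix_inv_mult[OF assms(1)])
  finally show ?thesis .
qed

lemma bdet_neq_0:
  fixes g :: "'n::finite matr"
  assumes "invertible g" "g ** diag_mat b = diag_mat b ** g"
  shows "bdet {i. b i = v} g \<noteq> 0"
  using bdet_mult[OF commute_preserves[OF assms(2)], of v "matrix_inv g"]
  by (auto simp: matrix_inv_mult[OF assms(1)])

lemma log_char_mult:
  fixes g h :: "'n::finite matr"
  assumes "invertible g" "g ** diag_mat b = diag_mat b ** g"
    and "invertible h" "h ** diag_mat b = diag_mat b ** h"
  shows "log_char b (g ** h) = log_char b g + log_char b h"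
  unfolding log_char_def sum.distrib[symmetric]
  by (intro sum.cong refl)
    (simp add: bdet_mult commute_preserves[OF assms(2)] abs_mult ln_mult
      bdet_neq_0[OF assms(1,2)] bdet_neq_0[OF assms(3,4)] distrib_left)

lemma log_char_matrix_inv:
  fixes g :: "'n::finite matr"
  assumes "invertible g" "g ** diag_mat b = diag_mat b ** g"
  shows "log_char b (matrix_inv g) = - log_char b g"
proof -
  have "invertible (matrix_inv g)"
    using matrix_inv_unique(2)[OF matrix_inv_mult(2)[OF assms(1)]] .
  then have "log_char b (g ** matrix_inv g) = log_char b g + log_char b (matrix_inv g)"
    by (intro log_char_mult assms matrix_inv_commute)
  then show ?thesis
    by (simp add: matrix_inv_mult[OF assms(1)]) (simp add: log_char_def)
qed

lemma sum_range_level_sets: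
  fixes b :: "'n::finite \<Rightarrow> real"
  shows "(\<Sum>v\<in>range b. v * (\<Sum>i | b i = v. f i)) = (\<Sum>i\<in>UNIV. b i * f i)"
proof -
  have "(\<Sum>i\<in>UNIV. b i * f i) = (\<Sum>v\<in>range b. \<Sum>i | i \<in> UNIV \<and> b i = v. b i * f i)"
    by (rule sum.image_gen) simp
  then show ?thesis
    by (simp add: sum_distrib_left)
qed

lemma log_char_mexp:
  assumes "A ** diag_mat b = diag_mat b ** A"
  shows "log_char b (mexp A) = inner A (diag_mat b)"
  by (simp add: log_char_def bdet_mexp commute_preserves[OF assms] sum_range_level_sets
      inner_diag_mat_right mult.commute)

lemma log_char_diag_mat:
  assumes "\<And>i. a i \<noteq> 0"
  shows "log_char b (diag_mat a) = (\<Sum>i\<in>UNIV. b i * ln \<bar>a i\<bar>)"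
  using assms by (simp add: log_char_def bdet_diag_mat abs_prod ln_prod sum_range_level_sets)

lemma log_char_orthogonal:
  assumes "orthogonal_matrix k" "k ** diag_mat b = diag_mat b ** k"
  shows "log_char b k = 0"
  by (simp add: log_char_def abs_bdet_orthogonal[OF assms(1) commute_preserves[OF assms(2)]])

section \<open>The group \<open>H_beta\<close>\<close>

text \<open>Induction over the generators: on exponentials \<open>log_char\<close> is the inner
  product with \<beta>, which vanishes on \<open>h_beta\<close>, and it is additive on the
  centralizer.\<close>

lemma H_beta_props:
  assumes "h \<in> H_beta (diag_mat b)"
  shows "invertible h" "h ** diag_mat b = diag_mat b ** h" "log_char b h = 0"
proof -
  have "invertible h \<and> h ** diag_mat b = diag_mat b ** h \<and> log_char b h = 0"
    using assms unfolding H_beta_def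
  proof induction
    case one
    then show ?case by (simp add: log_char_def invertible_det_nz)
  next
    case (exp A)
    then have A: "A ** diag_mat b = diag_mat b ** A" "inner A (diag_mat b) = 0"
      by (auto simp: h_beta_def g_beta_def)
    then show ?case
      using mexp_intertwine[of "diag_mat b" A A] by (simp add: invertible_mexp log_char_mexp)
  next
    case (mult g h)
    then show ?case
      by (simp add: log_char_mult invertible_mult) (metis matrix_mul_assoc)
  next
    case (inv g)
    then show ?case
      using matrix_inv_unique(2)[OF matrix_inv_mult(2), of g]
      by (simp add: log_char_matrix_inv matrix_inv_commute)
  qed
  then show "invertible h" "h ** diag_mat b = diag_mat b ** h" "log_char b h = 0" by auto
qed

lemma H_beta_diag_exp:
  assumes "(\<Sum>i\<in>UNIV. a i * b i) = 0"
  shows "diag_mat (\<lambda>i. exp (a i)) \<in> H_beta (diag_mat b)"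
  unfolding H_beta_def mexp_diag_mat[symmetric]
  using assms by (intro connected_lie_subgroup.exp)
    (auto simp: h_beta_def g_beta_def diag_mat_mult inner_diag_mat_right mult.commute)

text \<open>Conjugation by an m commuting with \<beta> preserves commutation with \<beta> and, by
  cyclicity of the trace, orthogonality to \<beta>; so it maps generators to generators.\<close>

lemma H_beta_conjugate:
  assumes m: "invertible m" "m ** diag_mat b = diag_mat b ** m"
    and h: "h \<in> H_beta (diag_mat b)"
  shows "m ** h ** matrix_inv m \<in> H_beta (diag_mat b)"
  using h unfolding H_beta_def
proof induction
  case one
  then show ?case
    by (simp add: matrix_inv_mult[OF m(1)] connected_lie_subgroup.one)
next
  case (exp A)
  let ?A = "m ** A ** matrix_inv m"
  have "m ** mexp A = mexp ?A ** m"
    by (rule mexp_intertwine) (simp add: matrix_mul_assoc[symmetric] matrix_inv_mult[OF m(1)])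
  then have e: "m ** mexp A ** matrix_inv m = mexp ?A"
    by (simp add: matrix_mul_assoc[symmetric] matrix_inv_mult[OF m(1)])
  have A: "A ** diag_mat b = diag_mat b ** A" "inner A (diag_mat b) = 0"
    using exp by (auto simp: h_beta_def g_beta_def)
  have i: "matrix_inv m ** diag_mat b = diag_mat b ** matrix_inv m"
    by (rule matrix_inv_commute[OF m])
  have c: "?A ** diag_mat b = diag_mat b ** ?A"
    by (metis A(1) i m(2) matrix_mul_assoc)
  have t: "inner X (diag_mat b) = trace (X ** diag_mat b)" for X :: "'a matr"
  proof -
    have "transpose (diag_mat b) = diag_mat b" by (simp add: vec_eq_iff transpose_def)
    then show ?thesis by (simp add: inner_eq_trace)
  qed
  have "inner ?A (diag_mat b) = trace (m ** (A ** diag_mat b ** matrix_inv m))"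
    unfolding t by (metis i matrix_mul_assoc)
  also have "\<dots> = trace (A ** diag_mat b ** matrix_inv m ** m)"
    by (rule trace_mul_sym)
  also have "\<dots> = 0"
    using A(2) unfolding t by (simp add: matrix_mul_assoc[symmetric] matrix_inv_mult[OF m(1)])
  finally have "?A \<in> h_beta (diag_mat b)" using c by (simp add: h_beta_def g_beta_def)
  then show ?case unfolding e by (rule connected_lie_subgroup.exp)
next
  case (mult g h)
  have "m ** (g ** h) ** matrix_inv m = (m ** g ** matrix_inv m) ** (m ** h ** matrix_inv m)"
    by (metis matrix_inv_mult(2)[OF m(1)] matrix_mul_assoc matrix_mul_rid)
  then show ?case using mult by (simp add: connected_lie_subgroup.mult)
next
  case (inv g)
  have g: "invertible g" using inv H_beta_props(1) by (simp add: H_beta_def)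
  have "m ** matrix_inv g ** matrix_inv m = matrix_inv (m ** g ** matrix_inv m)"
  proof (rule matrix_inv_unique(1)[symmetric])
    have "m ** g ** matrix_inv m ** (m ** matrix_inv g ** matrix_inv m)
        = m ** (g ** (matrix_inv m ** m) ** matrix_inv g) ** matrix_inv m"
      by (simp add: matrix_mul_assoc)
    then show "m ** g ** matrix_inv m ** (m ** matrix_inv g ** matrix_inv m) = mat 1"
      by (simp add: matrix_inv_mult[OF m(1)] matrix_inv_mult[OF g])
  qed
  then show ?case using inv by (simp add: connected_lie_subgroup.inv)
qed

section \<open>The parabolic subgroup of a diagonal matrix\<close>

text \<open>The matrices that, with their inverses, stay bounded under conjugation by exp(-t
  \<beta>) as t grows, for \<beta> = \<open>diag_mat b\<close>. Listing the inverse makes closure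
  under inversion immediate.\<close>

definition parabolic :: "('n \<Rightarrow> real) \<Rightarrow> 'n::finite matr set" where
  "parabolic b = {p. invertible p \<and> (\<forall>i j. p $ i $ j \<noteq> 0 \<longrightarrow> b j \<le> b i)
     \<and> (\<forall>i j. matrix_inv p $ i $ j \<noteq> 0 \<longrightarrow> b j \<le> b i)}"

lemma matrix_inv_invertible:
  fixes g :: "'n::finite matr"
  assumes "invertible g"
  shows "invertible (matrix_inv g)" "matrix_inv (matrix_inv g) = g"
  using matrix_inv_unique[OF matrix_inv_mult(2)[OF assms]] by auto

lemma mult_nth_neq_0:
  assumes "(A ** B) $ i $ j \<noteq> (0::real)"
  obtains k where "A $ i $ k \<noteq> 0" "B $ k $ j \<noteq> 0"
proof -
  have "(\<Sum>k\<in>UNIV. A $ i $ k * B $ k $ j) \<noteq> 0"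
    using assms by (simp add: matrix_matrix_mult_def)
  then obtain k where "A $ i $ k * B $ k $ j \<noteq> 0"
    by (meson sum.neutral)
  then show thesis using that by auto
qed

lemma parabolic_mult:
  assumes "p \<in> parabolic b" "q \<in> parabolic b"
  shows "p ** q \<in> parabolic b"
  using assms unfolding parabolic_def
  by (auto simp: matrix_inv_matrix_mult invertible_mult elim!: mult_nth_neq_0) (meson order_trans)+

lemma parabolic_one: "mat 1 \<in> parabolic b"
proof -
  have "matrix_inv (mat 1 :: 'a matr) = mat 1" "invertible (mat 1 :: 'a matr)"
    by (rule matrix_inv_unique[of "mat 1" "mat 1"], simp)+
  moreover have "i = j" if "(mat 1 :: 'a matr) $ i $ j \<noteq> 0" for i j
    using that by (simp add: mat_def split: if_splits)
  ultimately show ?thesis unfolding parabolic_def mem_Collect_eq by (metis order_refl)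
qed

lemma parabolic_matrix_inv: "p \<in> parabolic b \<Longrightarrow> matrix_inv p \<in> parabolic b"
  by (simp add: parabolic_def matrix_inv_invertible)

lemma coef_act_neq_0:
  assumes "coef (act g \<mu>) i j k \<noteq> 0"
  obtains a b c where "g $ k $ c \<noteq> 0" "matrix_inv g $ a $ i \<noteq> 0" "matrix_inv g $ b $ j \<noteq> 0"
    "coef \<mu> a b c \<noteq> 0"
proof -
  obtain c where "(\<Sum>a\<in>UNIV. \<Sum>b\<in>UNIV.
     g $ k $ c * (matrix_inv g $ a $ i * matrix_inv g $ b $ j * coef \<mu> a b c)) \<noteq> 0"
    using assms unfolding coef_act by (meson sum.neutral)
  then obtain a where "(\<Sum>b\<in>UNIV.
     g $ k $ c * (matrix_inv g $ a $ i * matrix_inv g $ b $ j * coef \<mu> a b c)) \<noteq> 0"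
    by (meson sum.neutral)
  then obtain b where "g $ k $ c * (matrix_inv g $ a $ i * matrix_inv g $ b $ j * coef \<mu> a b c) \<noteq> 0"
    by (meson sum.neutral)
  then show thesis using that by auto
qed

text \<open>A nonzero coefficient of \<open>act p \<mu>\<close> comes from a triple of \<mu> with
  lower or equal b at the output index and higher or equal b at the inputs; the pairing with the
  weight cannot drop.\<close>

lemma W_beta_act:
  assumes "\<mu> \<in> W_beta (diag_mat b)" "p \<in> parabolic b"
  shows "act p \<mu> \<in> W_beta (diag_mat b)"
proof -
  have "(norm (diag_mat b))\<^sup>2 \<le> inner (diag_mat b) (weight i j k)" if nz: "coef (act p \<mu>) i j k \<noteq> 0" for i j k
  proof -
    obtain i' j' k' where c: "p $ k $ k' \<noteq> 0" "matrix_inv p $ i' $ i \<noteq> 0" "matrix_inv p $ j' $ j \<noteq> 0"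
      "coef \<mu> i' j' k' \<noteq> 0"
      by (rule coef_act_neq_0[OF nz])
    have "(norm (diag_mat b))\<^sup>2 \<le> inner (diag_mat b) (weight i' j' k')"
      using assms(1) c(4) by (auto simp: W_beta_iff)
    also have "\<dots> \<le> inner (diag_mat b) (weight i j k)"
    proof -
      have "b k' \<le> b k" "b i \<le> b i'" "b j \<le> b j'" using assms(2) c by (auto simp: parabolic_def)
      then show ?thesis by (simp add: inner_weight)
    qed
    finally show ?thesis .
  qed
  then show ?thesis using assms(1) by (auto simp: W_beta_iff act_in_V)
qed

lemma commute_in_parabolic:
  assumes "invertible h" "h ** diag_mat b = diag_mat b ** h"
  shows "h \<in> parabolic b"
  using assms matrix_inv_commute[OF assms] by (auto simp: parabolic_def commute_diag_mat_iff)

lemma coef_act_diag_exp: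
  "coef (act (diag_mat (\<lambda>i. exp (a i))) \<mu>) i j k = exp (a k - a i - a j) * coef \<mu> i j k"
  by (subst coef_act_diag_mat) (auto simp: exp_diff)

text \<open>The one-parameter group of \<open>\<gamma> + \<langle>\<gamma>, \<beta>\<rangle>I\<close>, with \<open>\<gamma>\<close> the vector \<open>beta_of x\<close>, lies in \<open>H_beta \<beta>\<close> since
  \<open>tr \<beta> = -1\<close>, and drives \<open>x\<close> to \<open>0\<close>.\<close>

lemma not_semistable:
  fixes x :: "'n::{finite,linorder} bilin"
  assumes x: "x \<in> V" "x \<noteq> 0" and tr: "(\<Sum>i\<in>UNIV. b i) = - 1"
    and lt: "norm (diag_mat b) < norm (beta_of x)"
  shows "\<not> semistable (H_beta (diag_mat b)) x"
proof -
  define \<gamma> where "\<gamma> = beta_of x"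
  define s where "s = inner \<gamma> (diag_mat b)"
  define \<eta> where "\<eta> i = \<gamma> $ i $ i + s" for i
  define g where "g t = diag_mat (\<lambda>i. exp (- t * \<eta> i))" for t
  have "(\<Sum>i\<in>UNIV. \<eta> i * b i) = s + s * (\<Sum>i\<in>UNIV. b i)"
    by (simp add: \<eta>_def s_def inner_diag_mat_right distrib_right sum.distrib sum_distrib_left)
  then have "(\<Sum>i\<in>UNIV. - t * \<eta> i * b i) = 0" for t
    using tr by (simp add: sum_negf mult.assoc sum_distrib_left[symmetric])
  then have gH: "g t \<in> H_beta (diag_mat b)" for t
    unfolding g_def by (rule H_beta_diag_exp)
  have c: "coef (act (g t) x) i j k = exp (- t * (\<eta> k - \<eta> i - \<eta> j)) * coef x i j k" for t i j k
    unfolding g_def coef_act_diag_exp by (simp add: algebra_simps)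
  \<comment> \<open>Weights have trace -1, so passing from \<gamma> to \<eta> lowers each pairing by
    s. Pairings with \<gamma> are at least the squared norm, so those with \<eta> become
    positive.\<close>
  have "s < (norm \<gamma>)\<^sup>2"
  proof -
    have "s \<le> norm \<gamma> * norm (diag_mat b)" unfolding s_def by (rule norm_cauchy_schwarz)
    also have "\<dots> < norm \<gamma> * norm \<gamma>"
      using lt norm_ge_zero[of "diag_mat b"] unfolding \<gamma>_def by (intro mult_strict_left_mono) linarith+
    finally show ?thesis by (simp add: power2_eq_square)
  qed
  then have pos: "0 < \<eta> k - \<eta> i - \<eta> j" if "coef x i j k \<noteq> 0" for i j k
    using inner_beta_of_ge[OF x(1) that] by (simp add: \<eta>_def \<gamma>_def inner_weight)
  have "((\<lambda>t. act (g t) x) \<longlongrightarrow> 0) at_top"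
  proof (rule tendsto_coefI)
    fix i j k
    have "((\<lambda>t. exp (- t * (\<eta> k - \<eta> i - \<eta> j)) * coef x i j k) \<longlongrightarrow> 0) at_top"
    proof (cases "coef x i j k = 0")
      case False
      have "filterlim (\<lambda>t. (\<eta> k - \<eta> i - \<eta> j) * t) at_top at_top"
        using pos[OF False] by (intro filterlim_tendsto_pos_mult_at_top[OF tendsto_const _ filterlim_ident])
      then have "((\<lambda>t. exp (- t * (\<eta> k - \<eta> i - \<eta> j))) \<longlongrightarrow> 0) at_top"
        by (intro filterlim_compose[OF exp_at_bot]) (simp add: filterlim_uminus_at_top mult.commute)
      then show ?thesis by (rule tendsto_mult_left_zero)
    qed simp
    then show "((\<lambda>t. coef (act (g t) x) i j k) \<longlongrightarrow> coef 0 i j k) at_top"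
      unfolding c by (simp add: coef_def)
  qed
  then have lim: "((\<lambda>t. norm (act (g t) x)) \<longlongrightarrow> 0) at_top"
    by (rule tendsto_norm_zero)
  show ?thesis
  proof
    assume "semistable (H_beta (diag_mat b)) x"
    then obtain e where "e > 0" "\<And>h. h \<in> H_beta (diag_mat b) \<Longrightarrow> e \<le> norm (act h x)"
      by (auto simp: semistable_iff)
    then show False
      using order_tendstoD(2)[OF lim, of e] gH by (auto simp: eventually_at_top_linorder) (meson not_le order_refl)
  qed
qed

lemma tendsto_act:
  fixes g :: "'a \<Rightarrow> 'n::finite matr"
  assumes "\<And>i j. ((\<lambda>t. g t $ i $ j) \<longlongrightarrow> m $ i $ j) F"
    and "\<And>i j. ((\<lambda>t. matrix_inv (g t) $ i $ j) \<longlongrightarrow> matrix_inv m $ i $ j) F"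
    and "\<And>i j k. ((\<lambda>t. coef (f t) i j k) \<longlongrightarrow> coef l i j k) F"
  shows "((\<lambda>t. act (g t) (f t)) \<longlongrightarrow> act m l) F"
  by (rule tendsto_coefI) (unfold coef_act, intro tendsto_sum tendsto_mult assms)

lemma exists_bilin_coef: "\<exists>\<mu> :: 'n::finite bilin. \<forall>i j k. coef \<mu> i j k = f i j k"
proof -
  let ?F = "\<lambda>X Y. \<chi> k. \<Sum>i\<in>UNIV. \<Sum>j\<in>UNIV. X $ i * Y $ j * f i j k"
  have "bilinear ?F"
    by (auto simp: bilinear_def vec_eq_iff algebra_simps sum.distrib sum_distrib_left intro!: linearI)
  have "coef (bilin ?F) i j k
      = (\<Sum>i'\<in>UNIV. \<Sum>j'\<in>UNIV. if j' = j then if i' = i then f i' j' k else 0 else 0)" for i j k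
    unfolding coef_def bilin_apply[OF \<open>bilinear ?F\<close>] vec_lambda_beta
    by (intro sum.cong refl) (simp add: axis_def)
  then have "coef (bilin ?F) i j k = f i j k" for i j k by simp
  then show ?thesis by blast
qed

text \<open>A central one-parameter group of \<open>H_beta\<close> contracts \<open>W_beta\<close> onto \<open>Z_beta\<close> and \<open>p\<close> onto its Levi
  factor \<open>m\<close>, which normalizes \<open>H_beta\<close>.\<close>

lemma semistable_act_parabolic:
  fixes \<mu> :: "'n::{finite,linorder} bilin"
  assumes tr: "(\<Sum>i\<in>UNIV. b i) = - 1" and \<mu>: "\<mu> \<in> W_beta (diag_mat b)"
    and ss: "semistable (H_beta (diag_mat b)) \<mu>" and p: "p \<in> parabolic b"
  shows "semistable (H_beta (diag_mat b)) (act p \<mu>)"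
proof -
  let ?H = "H_beta (diag_mat b)"
  obtain c where c: "c > 0" "\<And>h. h \<in> ?H \<Longrightarrow> c \<le> norm (act h \<mu>)"
    using ss by (auto simp: semistable_iff)
  define N where "N = (norm (diag_mat b))\<^sup>2"
  have N: "N = (\<Sum>i\<in>UNIV. b i * b i)"
    by (simp add: N_def power2_norm_eq_inner inner_diag_mat_right)
  have "diag_mat b \<noteq> 0"
  proof
    assume "diag_mat b = 0"
    then have "b i = 0" for i by (metis diag_mat_nth zero_index)
    then show False using tr by simp
  qed
  then have N0: "N > 0" by (simp add: N_def)
  \<comment> \<open>Orthogonal to b because b sums to -1. The pairing with a weight w is <\<beta>,
    w>/N - 1: nonnegative on \<open>W_beta\<close> and zero exactly for the weights of
    \<open>Z_beta\<close>.\<close>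
  define \<eta> where "\<eta> i = 1 + b i / N" for i
  define a where "a t = diag_mat (\<lambda>i. exp (- t * \<eta> i))" for t
  have "(\<Sum>i\<in>UNIV. \<eta> i * b i) = 0"
    using N0 by (simp add: \<eta>_def distrib_right sum.distrib tr sum_divide_distrib[symmetric] N[symmetric])
  then have "(\<Sum>i\<in>UNIV. - t * \<eta> i * b i) = 0" for t
    by (simp add: sum_negf mult.assoc sum_distrib_left[symmetric])
  then have aH: "a t \<in> ?H" for t unfolding a_def by (rule H_beta_diag_exp)
  have ia: "matrix_inv (a t) = diag_mat (\<lambda>i. exp (t * \<eta> i))" "invertible (a t)" for t
    using matrix_inv_unique[of "a t" "diag_mat (\<lambda>i. exp (t * \<eta> i))"]
    by (simp_all add: a_def diag_mat_mult exp_add[symmetric] mat_1_eq_diag_mat)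
  have coef_a: "coef (act (a t) x) i j k = exp (- t * (\<eta> k - \<eta> i - \<eta> j)) * coef x i j k" for t x i j k
    unfolding a_def coef_act_diag_exp by (simp add: algebra_simps)
  have \<eta>_w: "\<eta> k - \<eta> i - \<eta> j = inner (diag_mat b) (weight i j k) / N - 1" for i j k
    by (simp add: \<eta>_def inner_weight diff_divide_distrib)
  have \<eta>_nonneg: "0 \<le> \<eta> k - \<eta> i - \<eta> j" if "x \<in> W_beta (diag_mat b)" "coef x i j k \<noteq> 0" for x i j k
    using that N0 by (simp add: \<eta>_w W_beta_iff N_def[symmetric])
  have exp_lim: "((\<lambda>t. exp (- t * r)) \<longlongrightarrow> (if r = 0 then 1 else 0)) at_top" if "r \<ge> 0" for r :: real
  proof (cases "r = 0")
    case False
    then have "filterlim (\<lambda>t. r * t) at_top at_top"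
      using that by (intro filterlim_tendsto_pos_mult_at_top[OF tendsto_const _ filterlim_ident]) simp
    then have "((\<lambda>t. exp (- t * r)) \<longlongrightarrow> 0) at_top"
      by (intro filterlim_compose[OF exp_at_bot]) (simp add: filterlim_uminus_at_top mult.commute)
    then show ?thesis using False by simp
  qed simp
  \<comment> \<open>The component of \<mu> with exponent 0, which is the limit of
    \<open>act (a t) \<mu>\<close>.\<close>
  obtain \<zeta> where \<zeta>: "\<And>i j k. coef \<zeta> i j k = (if \<eta> k - \<eta> i - \<eta> j = 0 then 1 else 0) * coef \<mu> i j k"
    using exists_bilin_coef[of "\<lambda>i j k. (if \<eta> k - \<eta> i - \<eta> j = 0 then 1 else 0) * coef \<mu> i j k"] by blast
  have a_lim: "((\<lambda>t. coef (act (a t) \<mu>) i j k) \<longlongrightarrow> coef \<zeta> i j k) at_top" for i j k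
  proof (cases "coef \<mu> i j k = 0")
    case False
    then show ?thesis
      unfolding coef_a \<zeta> by (intro tendsto_mult_right exp_lim \<eta>_nonneg[OF \<mu>])
  qed (simp add: coef_a \<zeta>)
  define lv where "lv q = (\<chi> i j. (if b i = b j then 1 else 0) * q $ i $ j)" for q :: "'n matr"
  let ?q = "matrix_inv p"
  let ?m = "lv p"
  have tri: "b j \<le> b i" if "p $ i $ j \<noteq> 0 \<or> ?q $ i $ j \<noteq> 0" for i j
    using p that by (auto simp: parabolic_def)
  have ip: "invertible p" using p by (simp add: parabolic_def)
  \<comment> \<open>A nonzero product of entries needs b i \<ge> b k \<ge> b j, so b i = b j forces
    b k to agree: here taking Levi parts is multiplicative.\<close>
  have "(lv p ** lv ?q) $ i $ j = mat 1 $ i $ j" for i j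
  proof (cases "b i = b j")
    case True
    have "lv p $ i $ k * lv ?q $ k $ j = p $ i $ k * ?q $ k $ j" for k
    proof (cases "p $ i $ k = 0 \<or> ?q $ k $ j = 0")
      case False
      then have "b k \<le> b i" "b j \<le> b k" using tri[of i k] tri[of k j] by auto
      then have "b k = b i" "b k = b j" using True by linarith+
      then show ?thesis by (simp add: lv_def)
    qed (auto simp: lv_def)
    then have "(lv p ** lv ?q) $ i $ j = (p ** ?q) $ i $ j"
      unfolding matrix_matrix_mult_def vec_lambda_beta by (intro sum.cong refl)
    then show ?thesis by (simp add: matrix_inv_mult[OF ip])
  next
    case False
    have "lv p $ i $ k * lv ?q $ k $ j = 0" for k
      using False by (auto simp: lv_def)
    then have "(lv p ** lv ?q) $ i $ j = 0"
      unfolding matrix_matrix_mult_def vec_lambda_beta by (intro sum.neutral) blast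
    then show ?thesis using False by (auto simp: mat_def)
  qed
  then have "lv p ** lv ?q = mat 1" by (simp add: vec_eq_iff)
  then have im: "matrix_inv ?m = lv ?q" "invertible ?m" by (rule matrix_inv_unique)+
  have mb: "?m ** diag_mat b = diag_mat b ** ?m"
    by (auto simp: commute_diag_mat_iff lv_def)
  define q where "q t = a t ** p ** matrix_inv (a t)" for t
  have iq: "invertible (q t)" "matrix_inv (q t) = a t ** ?q ** matrix_inv (a t)" for t
    unfolding q_def
    by (simp_all add: matrix_inv_matrix_mult invertible_mult ip ia(2) matrix_inv_invertible matrix_mul_assoc)
  have conj_lim: "((\<lambda>t. (a t ** r ** matrix_inv (a t)) $ i $ j) \<longlongrightarrow> lv r $ i $ j) at_top"
    if "r = p \<or> r = ?q" for r i j
  proof (cases "r $ i $ j = 0")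
    case False
    have "(a t ** r ** matrix_inv (a t)) $ i $ j = exp (- t * ((b i - b j) / N)) * r $ i $ j" for t
    proof -
      have "- t * ((b i - b j) / N) = - t * \<eta> i + t * \<eta> j"
        by (simp add: \<eta>_def diff_divide_distrib algebra_simps)
      then have "exp (- t * ((b i - b j) / N)) = exp (- t * \<eta> i) * exp (t * \<eta> j)"
        by (simp only: exp_add)
      then show ?thesis
        unfolding ia(1) unfolding a_def diag_mat_mult_right diag_mat_mult_left by (simp only: mult_ac)
    qed
    moreover have "0 \<le> (b i - b j) / N"
      using tri[of i j] False that N0 by auto
    ultimately show ?thesis
      using tendsto_mult_right[OF exp_lim, of "(b i - b j) / N" "r $ i $ j"] N0
      by (simp add: lv_def)
  next
    case True
    then show ?thesis
      unfolding ia(1) unfolding a_def diag_mat_mult_right diag_mat_mult_left by (simp add: lv_def)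
  qed
  \<comment> \<open>Orbit points of \<zeta> are limits of orbit points of \<mu>, so the constant c
    carries over.\<close>
  have lower_\<zeta>: "c \<le> norm (act h \<zeta>)" if "h \<in> ?H" for h
  proof -
    have "((\<lambda>t. act h (act (a t) \<mu>)) \<longlongrightarrow> act h \<zeta>) at_top"
      by (intro tendsto_act tendsto_const a_lim)
    then have l: "((\<lambda>t. norm (act h (act (a t) \<mu>))) \<longlongrightarrow> norm (act h \<zeta>)) at_top"
      by (rule tendsto_norm)
    have "c \<le> norm (act h (act (a t) \<mu>))" for t
      using c(2)[of "h ** a t"] that aH[of t] H_beta_props(1)[OF that] ia(2)
      by (simp add: act_mult H_beta_def connected_lie_subgroup.mult)
    then show ?thesis
      by (intro tendsto_lowerbound[OF l]) auto
  qed
  obtain C where C: "C > 0" "\<And>x. norm (act (matrix_inv ?m) x) \<le> C * norm x"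
    using norm_act_bounded[of "matrix_inv ?m"] by blast
  \<comment> \<open>The number of coefficients, lost in comparing them with the operator
    norm.\<close>
  define K where "K = real (CARD('n)) ^ 3"
  have K: "K > 0" by (simp add: K_def)
  have contract: "norm (act (a t) x) \<le> K * norm x" if "t \<ge> 0" "x \<in> W_beta (diag_mat b)" for t x
  proof -
    have "\<bar>coef (act (a t) x) i j k\<bar> \<le> norm x" for i j k
    proof (cases "coef x i j k = 0")
      case False
      have "exp (- t * (\<eta> k - \<eta> i - \<eta> j)) \<le> 1"
        using \<eta>_nonneg[OF that(2) False] that(1) by (simp add: mult_nonneg_nonneg)
      then have "exp (- t * (\<eta> k - \<eta> i - \<eta> j)) * \<bar>coef x i j k\<bar> \<le> 1 * norm x"
        by (intro mult_mono abs_coef_le_norm) auto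
      then show ?thesis by (simp add: coef_a abs_mult)
    qed (simp add: coef_a)
    then have "(\<Sum>i\<in>UNIV. \<Sum>j\<in>UNIV. \<Sum>k\<in>UNIV. \<bar>coef (act (a t) x) i j k\<bar>)
        \<le> (\<Sum>i\<in>(UNIV::'n set). \<Sum>j\<in>(UNIV::'n set). \<Sum>k\<in>(UNIV::'n set). norm x)"
      by (intro sum_mono)
    also have "\<dots> = K * norm x" by (simp add: K_def power3_eq_cube)
    finally show ?thesis using norm_le_sum_coef[of "act (a t) x"] by linarith
  qed
  \<comment> \<open>With h' = m^-1 h m the chain is c \<le> |h' \<zeta>| \<le> C |h m \<zeta>|, and
    h m \<zeta> is the limit of a(t) h p \<mu>, of norm at most K |h p \<mu>|.\<close>
  have "c / (C * K) \<le> norm (act h (act p \<mu>))" if h: "h \<in> ?H" for h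
  proof -
    note hp = H_beta_props[OF h]
    let ?h = "matrix_inv ?m ** h ** ?m"
    have h': "?h \<in> ?H"
      using H_beta_conjugate[OF matrix_inv_invertible(1)[OF im(2)] matrix_inv_commute[OF im(2) mb] h]
      by (simp add: matrix_inv_invertible[OF im(2)])
    have hm: "act h (act ?m \<zeta>) = act ?m (act ?h \<zeta>)"
    proof -
      have "?m ** ?h = h ** ?m"
        by (simp add: matrix_mul_assoc matrix_inv_mult[OF im(2)])
      then show ?thesis
        using im(2) hp(1) H_beta_props(1)[OF h'] by (metis act_mult)
    qed
    have "c \<le> norm (act ?h \<zeta>)" by (rule lower_\<zeta>[OF h'])
    also have "act ?h \<zeta> = act (matrix_inv ?m) (act ?m (act ?h \<zeta>))"
      using act_mult[OF matrix_inv_invertible(1)[OF im(2)] im(2), of "act ?h \<zeta>"]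
      by (simp add: matrix_inv_mult[OF im(2)])
    also have "norm \<dots> \<le> C * norm (act h (act ?m \<zeta>))" unfolding hm by (rule C)
    finally have 1: "c \<le> C * norm (act h (act ?m \<zeta>))" .
    have "((\<lambda>t. act (q t) (act (a t) \<mu>)) \<longlongrightarrow> act ?m \<zeta>) at_top"
      by (rule tendsto_act) (auto simp: q_def iq(2)[unfolded q_def] im(1) intro!: conj_lim a_lim)
    then have "((\<lambda>t. act h (act (q t) (act (a t) \<mu>))) \<longlongrightarrow> act h (act ?m \<zeta>)) at_top"
      by (intro tendsto_act tendsto_const)
        (auto simp: coef_def intro!: tendsto_intros)
    then have l: "((\<lambda>t. norm (act h (act (q t) (act (a t) \<mu>)))) \<longlongrightarrow> norm (act h (act ?m \<zeta>))) at_top"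
      by (rule tendsto_norm)
    have eq: "act h (act (q t) (act (a t) \<mu>)) = act (a t) (act h (act p \<mu>))" for t
    proof -
      \<comment> \<open>h commutes with \<beta>, and \<eta> is a function of b.\<close>
      have "h ** a t = a t ** h"
        using hp(2) unfolding a_def commute_diag_mat_iff by (auto simp: \<eta>_def)
      moreover have "q t ** a t = a t ** p"
        by (simp add: q_def matrix_mul_assoc[symmetric] matrix_inv_mult[OF ia(2)])
      ultimately show ?thesis
        using hp(1) iq(1)[of t] ia(2)[of t] ip by (metis act_mult)
    qed
    have W: "act h (act p \<mu>) \<in> W_beta (diag_mat b)"
      by (intro W_beta_act \<mu> p commute_in_parabolic hp)
    have "norm (act h (act ?m \<zeta>)) \<le> K * norm (act h (act p \<mu>))"
    proof (rule tendsto_upperbound[OF l])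
      show "\<forall>\<^sub>F t in at_top. norm (act h (act (q t) (act (a t) \<mu>))) \<le> K * norm (act h (act p \<mu>))"
        unfolding eq using eventually_ge_at_top[of 0] by eventually_elim (rule contract[OF _ W])
    qed simp
    then have "c \<le> C * (K * norm (act h (act p \<mu>)))"
      using 1 C(1) by (meson mult_left_mono less_imp_le order_trans)
    then show ?thesis using C(1) K by (simp add: field_simps)
  qed
  then show ?thesis
    using c(1) C(1) K unfolding semistable_iff by (intro exI[of _ "c / (C * K)"]) auto
qed

section \<open>Bruhat decomposition\<close>

text \<open>Multiplied from the left, it clears a whole column in one go; its transpose, from the
  right, clears a row.\<close>

definition column_op :: "'n \<Rightarrow> ('n \<Rightarrow> real) \<Rightarrow> 'n::finite matr" where
  "column_op r v = (\<chi> i k. if k = r \<and> i \<noteq> r then v i else if i = k then 1 else 0)"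

lemma column_op_mult:
  "(column_op r v ** A) $ i $ j = (if i = r then A $ i $ j else A $ i $ j + v i * A $ r $ j)"
proof -
  have "(column_op r v ** A) $ i $ j = (\<Sum>k\<in>UNIV. (if k = i then A $ k $ j else 0)
      + (if k = r then if i = r then 0 else v i * A $ k $ j else 0))"
    unfolding matrix_matrix_mult_def column_op_def vec_lambda_beta
    by (intro sum.cong refl) auto
  then show ?thesis by (simp add: sum.distrib)
qed

lemma mult_transpose_column_op:
  "(A ** transpose (column_op r v)) $ i $ j = (if j = r then A $ i $ j else A $ i $ j + A $ i $ r * v j)"
proof -
  have "A ** transpose (column_op r v) = transpose (column_op r v ** transpose A)"
    by (simp add: matrix_transpose_mul)
  then show ?thesis by (simp add: transpose_def column_op_mult mult.commute)
qed

lemma matrix_inv_column_op: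
  fixes r :: "'n::finite"
  shows "matrix_inv (column_op r v) = column_op r (\<lambda>i. - v i)" "invertible (column_op r v)"
proof -
  have "column_op r v ** column_op r (\<lambda>i. - v i) = mat 1"
    by (auto simp: vec_eq_iff column_op_mult) (auto simp: column_op_def mat_def)
  then show "matrix_inv (column_op r v) = column_op r (\<lambda>i. - v i)" "invertible (column_op r v)"
    by (rule matrix_inv_unique)+
qed

lemma column_op_parabolic:
  assumes "\<And>i. i \<noteq> r \<Longrightarrow> v i \<noteq> 0 \<Longrightarrow> b r \<le> b i"
  shows "column_op r v \<in> parabolic b"
  unfolding parabolic_def mem_Collect_eq matrix_inv_column_op(1)
  using assms matrix_inv_column_op(2)[of r v] unfolding column_op_def by (auto split: if_splits)

lemma transpose_column_op_parabolic:
  assumes "\<And>i. i \<noteq> r \<Longrightarrow> v i \<noteq> 0 \<Longrightarrow> b i \<le> b r"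
  shows "transpose (column_op r v) \<in> parabolic b"
proof -
  have "transpose (column_op r v) ** transpose (column_op r (\<lambda>i. - v i)) = mat 1"
    by (simp flip: matrix_transpose_mul)
      (metis add.inverse_inverse matrix_inv_column_op matrix_inv_mult(2) transpose_mat)
  note i = matrix_inv_unique[OF this]
  show ?thesis
    unfolding parabolic_def mem_Collect_eq i(1)
    using assms i(2) unfolding column_op_def transpose_def by (auto split: if_splits)
qed

text \<open>Gaussian elimination. Columns are processed in decreasing order of \<open>b\<close>, and the pivot of a
  column is taken with the least value of \<open>c\<close>, so that only operations from the two parabolic
  subgroups are used.\<close>

lemma parabolic_elimination:
  fixes g :: "'n::finite matr"
  assumes g: "invertible g" and "n \<le> CARD('n)"
  shows "\<exists>p\<in>parabolic c. \<exists>q\<in>parabolic b. \<exists>C \<pi>. card C = n \<and> inj_on \<pi> C \<and>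
    (\<forall>j\<in>C. \<forall>l. l \<notin> C \<longrightarrow> b l \<le> b j) \<and>
    (\<forall>j\<in>C. \<forall>i. (p ** g ** q) $ i $ j \<noteq> 0 \<longleftrightarrow> i = \<pi> j) \<and>
    (\<forall>j\<in>C. \<forall>l. l \<noteq> j \<longrightarrow> (p ** g ** q) $ \<pi> j $ l = 0)"
  using assms(2)
proof (induction n)
  case 0
  show ?case by (intro bexI[OF _ parabolic_one] exI[of _ "{}"]) auto
next
  case (Suc n)
  then obtain p q C \<pi> where p: "p \<in> parabolic c" and q: "q \<in> parabolic b" and card: "card C = n"
    and inj: "inj_on \<pi> C" and up: "\<And>j l. j \<in> C \<Longrightarrow> l \<notin> C \<Longrightarrow> b l \<le> b j"
    and col: "\<And>j i. j \<in> C \<Longrightarrow> (p ** g ** q) $ i $ j \<noteq> 0 \<longleftrightarrow> i = \<pi> j"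
    and row: "\<And>j l. j \<in> C \<Longrightarrow> l \<noteq> j \<Longrightarrow> (p ** g ** q) $ \<pi> j $ l = 0"
    by auto
  define M where "M = p ** g ** q"
  have M: "invertible M"
    using p q g by (auto simp: M_def parabolic_def intro!: invertible_mult)
  have "- C \<noteq> {}"
    using card Suc.prems by (metis Compl_UNIV_eq Suc_n_not_le_n double_complement)
  then have "Max (b ` (- C)) \<in> b ` (- C)" by (intro Max_in) auto
  then obtain j where j: "j \<notin> C" and jmax: "\<And>l. l \<notin> C \<Longrightarrow> b l \<le> b j"
    by auto (metis ComplI Max_ge finite finite_imageI imageI)
  let ?R = "{i. M $ i $ j \<noteq> 0}"
  have "?R \<noteq> {}"
  proof
    assume "?R = {}"
    then have "(matrix_inv M ** M) $ j $ j = 0" by (simp add: matrix_matrix_mult_def)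
    then show False by (simp add: matrix_inv_mult[OF M] mat_def)
  qed
  then have "Min (c ` ?R) \<in> c ` ?R" by (intro Min_in) auto
  then obtain r where r: "M $ r $ j \<noteq> 0" and rmin: "\<And>i. M $ i $ j \<noteq> 0 \<Longrightarrow> c r \<le> c i"
    by auto (metis (mono_tags) Min_le finite finite_imageI imageI mem_Collect_eq)
  have rC: "r \<noteq> \<pi> l" if "l \<in> C" for l
    using row[OF that, of j] j that r unfolding M_def by auto
  \<comment> \<open>The pivot row vanishes in the processed columns, so the column operation leaves
    out these columns, whose b may exceed that of j.\<close>
  have rC0: "M $ r $ l = 0" if "l \<in> C" for l
    using col[OF that, of r] rC[OF that] unfolding M_def by auto
  let ?p = "column_op r (\<lambda>i. - (M $ i $ j / M $ r $ j))"
  let ?q = "transpose (column_op j (\<lambda>l. - (M $ r $ l / M $ r $ j)))"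
  have p': "?p ** p \<in> parabolic c"
    using rmin by (intro parabolic_mult p column_op_parabolic) auto
  have q': "q ** ?q \<in> parabolic b"
    using jmax rC0 by (intro parabolic_mult q transpose_column_op_parabolic) auto
  define M' where "M' = ?p ** M ** ?q"
  have M'_eq: "?p ** p ** g ** (q ** ?q) = M'"
    by (simp add: M'_def M_def matrix_mul_assoc)
  have M': "M' $ i $ l = (if i = r then if l = j then M $ r $ j else 0
      else if l = j then 0 else M $ i $ l - M $ i $ j * M $ r $ l / M $ r $ j)" for i l
    using r unfolding M'_def mult_transpose_column_op column_op_mult by (simp add: field_simps)
  let ?\<pi> = "\<pi>(j := r)"
  show ?case
  proof (intro bexI[OF _ p'] bexI[OF _ q'] exI[of _ "insert j C"] exI[of _ ?\<pi>] conjI ballI allI impI)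
    show "card (insert j C) = Suc n" using card j by simp
    show "inj_on ?\<pi> (insert j C)"
      using inj j rC by (auto simp: inj_on_def)
    show "b l \<le> b k" if "k \<in> insert j C" "l \<notin> insert j C" for k l
      using that up jmax by auto
    show "(?p ** p ** g ** (q ** ?q)) $ i $ k \<noteq> 0 \<longleftrightarrow> i = ?\<pi> k" if "k \<in> insert j C" for k i
    proof (cases "k = j")
      case False
      then have k: "k \<in> C" using that by simp
      then show ?thesis
        using col[OF k, of i] rC[OF k] rC0[OF k] False unfolding M'_eq M' M_def[symmetric] by auto
    qed (use r in \<open>auto simp: M'_eq M'\<close>)
    show "(?p ** p ** g ** (q ** ?q)) $ ?\<pi> k $ l = 0" if "k \<in> insert j C" "l \<noteq> k" for k l
    proof (cases "k = j")
      case False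
      then have k: "k \<in> C" using that by simp
      then show ?thesis
        using row[OF k that(2)] row[OF k, of j] rC[OF k] j False unfolding M'_eq M' M_def[symmetric] by auto
    qed (use that in \<open>auto simp: M'_eq M'\<close>)
  qed
qed

text \<open>Elimination run through all columns. The application takes c from \<open>beta_of\<close>
  of the moved vector and b from \<beta>.\<close>

lemma bruhat_decomposition:
  fixes g :: "'n::finite matr"
  assumes g: "invertible g"
  obtains p q \<pi> where "p \<in> parabolic c" "q \<in> parabolic b" "bij \<pi>"
    "\<And>i j. (p ** g ** q) $ i $ j \<noteq> 0 \<longleftrightarrow> i = \<pi> j"
proof -
  obtain p q C \<pi> where "p \<in> parabolic c" "q \<in> parabolic b" "card C = CARD('n)" "inj_on \<pi> C"
    "\<forall>j\<in>C. \<forall>i. (p ** g ** q) $ i $ j \<noteq> 0 \<longleftrightarrow> i = \<pi> j"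
    using parabolic_elimination[OF g order_refl, of c b] by (elim bexE exE conjE) (rule that)
  moreover from this have "C = UNIV" by (simp add: card_eq_UNIV_imp_eq_UNIV)
  ultimately show thesis
    using that[of p q \<pi>] by (simp add: bij_def finite_UNIV_inj_surj)
qed

text \<open>A monomial matrix permutes the coordinate lines, hence permutes the coefficients up to
  nonzero factors.\<close>

lemma coef_act_monomial:
  fixes M :: "'n::finite matr"
  assumes M: "invertible M" and nz: "\<And>i j. M $ i $ j \<noteq> 0 \<longleftrightarrow> i = \<pi> j"
    and "coef \<mu> i j k \<noteq> 0"
  shows "coef (act M \<mu>) (\<pi> i) (\<pi> j) (\<pi> k) \<noteq> 0"
proof -
  have ax: "M *v axis l 1 = M $ \<pi> l $ l *\<^sub>R axis (\<pi> l) 1" for l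
  proof -
    have "M $ i $ l = 0" if "i \<noteq> \<pi> l" for i using nz[of i l] that by auto
    then show ?thesis
      by (simp add: matrix_vector_mult_basis column_def) (auto simp: vec_eq_iff axis_def)
  qed
  define d where "d l = M $ \<pi> l $ l" for l
  have d: "d l \<noteq> 0" for l using nz[of "\<pi> l" l] by (simp add: d_def)
  have iax: "matrix_inv M *v axis (\<pi> l) 1 = (1 / d l) *\<^sub>R axis l 1" for l
  proof -
    have "axis l 1 = matrix_inv M *v (M *v axis l 1)"
      by (simp add: matrix_vector_mul_assoc matrix_inv_mult[OF M])
    also have "\<dots> = d l *\<^sub>R (matrix_inv M *v axis (\<pi> l) 1)"
      unfolding ax by (simp add: matrix_vector_mult_scaleR d_def)
    finally show ?thesis using d[of l] by simp
  qed
  have "M $ \<pi> k $ l = (if l = k then d k else 0)" for l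
  proof (cases "l = k")
    case False
    have "inj \<pi>"
    proof (rule injI)
      fix x y assume "\<pi> x = \<pi> y"
      then have "(1 / d x) *\<^sub>R axis x (1::real) = (1 / d y) *\<^sub>R axis y 1"
        using iax[of x] iax[of y] by simp
      then show "x = y"
        using d[of x] by (auto simp: vec_eq_iff axis_def) (metis divide_eq_0_iff zero_neq_one)
    qed
    then show ?thesis using False nz[of "\<pi> k" l] by (auto simp: inj_def)
  qed (simp add: d_def)
  then have "(M *v y) $ \<pi> k = d k * y $ k" for y
    by (simp add: matrix_vector_mult_def if_distrib[where f = "\<lambda>x. x * _"] cong: if_cong)
  then have "coef (act M \<mu>) (\<pi> i) (\<pi> j) (\<pi> k) = d k * (1 / d i * (1 / d j * coef \<mu> i j k))"
    by (simp add: coef_def act_apply iax blinfun.scaleR_left blinfun.scaleR_right)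
  then show ?thesis using d assms(3) by simp
qed

section \<open>Semistable vectors lie in the stratum\<close>

lemma semistable_imp_neq_0:
  assumes "semistable (H_beta \<beta>) \<mu>"
  shows "\<mu> \<noteq> 0"
  using assms connected_lie_subgroup.one[of "h_beta \<beta>"]
  unfolding semistable_iff H_beta_def by fastforce

lemma semistable_norm_le:
  fixes \<mu> :: "'n::{finite,linorder} bilin"
  assumes tr: "(\<Sum>i\<in>UNIV. b i) = - 1" and \<mu>: "\<mu> \<in> W_beta (diag_mat b)"
    and ss: "semistable (H_beta (diag_mat b)) \<mu>" and g: "invertible g"
  shows "norm (beta_of (act g \<mu>)) \<le> norm (diag_mat b)"
proof (rule ccontr)
  assume "\<not> ?thesis"
  then have lt: "norm (diag_mat b) < norm (beta_of (act g \<mu>))" by simp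
  have V: "\<mu> \<in> V" using \<mu> by (simp add: W_beta_def)
  define y where "y = act g \<mu>"
  have yV: "y \<in> V" using V by (simp add: y_def act_in_V)
  have "\<mu> = act (matrix_inv g) y"
    unfolding y_def using act_mult[OF matrix_inv_invertible(1)[OF g] g, of \<mu>]
    by (simp add: matrix_inv_mult[OF g])
  then have y0: "y \<noteq> 0" using semistable_imp_neq_0[OF ss] by auto
  define c where "c i = beta_of y $ i $ i" for i
  have dc: "diag_mat c = beta_of y"
    using diagonal_eq_diag_mat[OF hull_weights_diagonal[OF beta_of_in_hull[OF yV y0]]]
    by (simp add: c_def[abs_def])
  obtain p q \<pi> where p: "p \<in> parabolic c" and q: "q \<in> parabolic b" and \<pi>: "bij \<pi>"
    and M: "\<And>i j. (p ** g ** q) $ i $ j \<noteq> 0 \<longleftrightarrow> i = \<pi> j"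
    using bruhat_decomposition[OF g, of c b] by metis
  define x where "x = act (matrix_inv q) \<mu>"
  have iv: "invertible p" "invertible q" using p q by (auto simp: parabolic_def)
  have ssx: "semistable (H_beta (diag_mat b)) x"
    unfolding x_def by (intro semistable_act_parabolic tr \<mu> ss parabolic_matrix_inv q)
  have xV: "x \<in> V" using V by (simp add: x_def act_in_V)
  have "act (p ** g ** q) x = act p (act g (act (q ** matrix_inv q) \<mu>))"
    using iv g by (simp add: x_def act_mult invertible_mult matrix_inv_invertible)
  then have Mx: "act (p ** g ** q) x = act p y"
    by (simp add: matrix_inv_mult[OF iv(2)] y_def)
  \<comment> \<open>The variational inequality for \<open>beta_of y\<close>; its parabolic subgroup,
    which contains p, preserves this space.\<close>
  have "y \<in> W_beta (diag_mat c)"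
    using inner_beta_of_ge[OF yV] yV by (simp add: W_beta_iff dc)
  then have W: "act (p ** g ** q) x \<in> W_beta (diag_mat c)"
    unfolding Mx using p by (rule W_beta_act)
  \<comment> \<open>Pulling c back along \<pi> undoes the permutation: the norm is that of
    \<open>beta_of y\<close>, and the weights of x satisfy the half-space inequality for this
    vector.\<close>
  let ?\<gamma> = "diag_mat (\<lambda>i. c (\<pi> i))"
  have "(\<Sum>i\<in>UNIV. c (\<pi> i) * c (\<pi> i)) = (\<Sum>i\<in>UNIV. c i * c i)"
    using \<pi> by (rule sum.reindex_bij_betw)
  then have n: "norm ?\<gamma> = norm (beta_of y)"
    unfolding dc[symmetric] by (simp add: norm_eq inner_diag_mat_right)
  have "norm ?\<gamma> \<le> norm (beta_of x)"
  proof (rule norm_le_norm_beta_of[OF xV semistable_imp_neq_0[OF ssx]])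
    fix i j k assume "coef x i j k \<noteq> 0"
    then have "coef (act (p ** g ** q) x) (\<pi> i) (\<pi> j) (\<pi> k) \<noteq> 0"
      by (intro coef_act_monomial M invertible_mult iv g)
    then have "(norm (diag_mat c))\<^sup>2 \<le> inner (diag_mat c) (weight (\<pi> i) (\<pi> j) (\<pi> k))"
      using W by (auto simp: W_beta_iff)
    then show "(norm ?\<gamma>)\<^sup>2 \<le> inner ?\<gamma> (weight i j k)"
      unfolding n dc[symmetric] by (simp add: inner_weight)
  qed
  then have "norm (diag_mat b) < norm (beta_of x)" using lt n unfolding y_def by simp
  then show False
    using not_semistable[OF xV semistable_imp_neq_0[OF ssx] tr] ssx by blast
qed

lemma semistable_in_Y_S:
  fixes \<mu> :: "'n::{finite,linorder} bilin"
  assumes tr: "(\<Sum>i\<in>UNIV. b i) = - 1" and \<mu>: "\<mu> \<in> W_beta (diag_mat b)"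
    and ss: "semistable (H_beta (diag_mat b)) \<mu>"
  shows "\<mu> \<in> Y_beta (diag_mat b) \<inter> S_beta (diag_mat b)"
proof -
  have i1: "invertible (mat 1 :: 'n matr)" by (rule matrix_inv_unique[of _ "mat 1"]) simp
  have n0: "\<mu> \<noteq> 0" by (rule semistable_imp_neq_0[OF ss])
  \<comment> \<open>g = I bounds the norm of \<open>beta_of \<mu>\<close>, which on
    \<open>W_beta\<close> forces equality.\<close>
  have e: "beta_of \<mu> = diag_mat b"
    using semistable_norm_le[OF tr \<mu> ss i1] by (intro beta_of_eqI \<mu> n0) simp
  have "diag_mat b = beta_of (act (mat 1) \<mu>)" using e by simp
  then have "diag_mat b \<in> {beta_of (act g \<mu>) | g. g \<in> GL}" using i1 unfolding GL_def by blast
  then have "\<mu> \<in> S_beta (diag_mat b)"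
    using semistable_norm_le[OF tr \<mu> ss] n0 \<mu> by (auto simp: S_beta_def GL_def W_beta_def)
  then show ?thesis using Y_betaI[OF \<mu> n0 e] by simp
qed

section \<open>Singular value decomposition in a centralizer\<close>

text \<open>A product of orthogonal groups, one for each eigenspace of
  \<open>diag_mat b\<close>.\<close>

definition centralizer_O :: "('n \<Rightarrow> real) \<Rightarrow> 'n::finite matr set" where
  "centralizer_O b = {k. orthogonal_matrix k \<and> k ** diag_mat b = diag_mat b ** k}"

lemma compact_centralizer_O: "compact (centralizer_O b)"
proof -
  have "centralizer_O b = (\<Inter>i. \<Inter>j. {k. (\<Sum>l\<in>UNIV. k $ l $ i * k $ l $ j) = mat 1 $ i $ j})
      \<inter> (\<Inter>i. \<Inter>j. {k. k $ i $ j * b j = b i * k $ i $ j})"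
    unfolding centralizer_O_def orthogonal_matrix vec_eq_iff diag_mat_mult_left diag_mat_mult_right
    unfolding matrix_matrix_mult_def transpose_def vec_lambda_beta by blast
  then have "closed (centralizer_O b)"
    by (simp only:) (intro closed_Int closed_INT ballI closed_Collect_eq continuous_intros)
  moreover have "bounded (centralizer_O b)"
  proof -
    have "norm k = sqrt (trace (mat 1 :: 'a matr))" if "k \<in> centralizer_O b" for k
      using that by (simp add: norm_eq_sqrt_inner inner_eq_trace centralizer_O_def orthogonal_matrix_def)
    then show ?thesis by (auto simp: bounded_iff)
  qed
  ultimately show ?thesis by (simp add: compact_eq_bounded_closed)
qed

lemma centralizer_O_mult:
  "k \<in> centralizer_O b \<Longrightarrow> l \<in> centralizer_O b \<Longrightarrow> k ** l \<in> centralizer_O b"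
  by (auto simp: centralizer_O_def orthogonal_matrix_mul) (metis matrix_mul_assoc)

lemma centralizer_O_transpose: "k \<in> centralizer_O b \<Longrightarrow> transpose k \<in> centralizer_O b"
  by (auto simp: centralizer_O_def commute_diag_mat_iff transpose_def[of k, THEN arg_cong[where f = "\<lambda>A. A $ _ $ _"]])

lemma centralizer_O_one: "mat 1 \<in> centralizer_O b"
  by (simp add: centralizer_O_def orthogonal_matrix_id)

definition rot :: "'n \<Rightarrow> 'n \<Rightarrow> real \<Rightarrow> real \<Rightarrow> 'n::finite matr" where
  "rot i j x y = (\<chi> p q. if p = i then if q = i then x else if q = j then - y else 0
    else if p = j then if q = i then y else if q = j then x else 0
    else if p = q then 1 else 0)"

lemma rot_mult:
  assumes "i \<noteq> j"
  shows "(rot i j x y ** A) $ p $ q = (if p = i then x * A $ i $ q - y * A $ j $ q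
    else if p = j then y * A $ i $ q + x * A $ j $ q else A $ p $ q)"
proof -
  have "(rot i j x y ** A) $ p $ q = (\<Sum>k\<in>UNIV.
      (if k = i then (if p = i then x else if p = j then y else 0) * A $ k $ q else 0)
    + (if k = j then (if p = i then - y else if p = j then x else 0) * A $ k $ q else 0)
    + (if k = p then if p = i \<or> p = j then 0 else A $ k $ q else 0))"
    unfolding matrix_matrix_mult_def rot_def vec_lambda_beta
    using assms by (intro sum.cong refl) auto
  then show ?thesis using assms by (simp add: sum.distrib)
qed

lemma rot_centralizer_O:
  assumes "i \<noteq> j" "b i = b j" "x\<^sup>2 + y\<^sup>2 = 1"
  shows "rot i j x y \<in> centralizer_O b"
proof -
  have "transpose (rot i j x y) = rot i j x (- y)"
    using assms(1) by (auto simp: vec_eq_iff transpose_def rot_def)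
  moreover have "rot i j x (- y) ** rot i j x y = mat 1"
  proof -
    have s: "x * x + y * y = 1" "y * y + x * x = 1"
      using assms(3) by (simp_all add: power2_eq_square)
    have "(rot i j x (- y) ** rot i j x y) $ p $ q = mat 1 $ p $ q" for p q
      unfolding rot_mult[OF assms(1)]
      by (cases "p = i"; cases "p = j"; cases "q = i"; cases "q = j")
        (use assms(1) in \<open>simp_all add: rot_def mat_def s mult.commute[of y x]\<close>)
    then show ?thesis by (simp add: vec_eq_iff)
  qed
  ultimately have "orthogonal_matrix (rot i j x y)" by (simp add: orthogonal_matrix)
  moreover have "rot i j x y ** diag_mat b = diag_mat b ** rot i j x y"
    unfolding commute_diag_mat_iff
  proof (intro allI impI)
    fix p q assume "rot i j x y $ p $ q \<noteq> 0"
    then have "p = q \<or> (p = i \<or> p = j) \<and> (q = i \<or> q = j)"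
      by (auto simp: rot_def split: if_splits)
    then show "b p = b q" using assms(2) by metis
  qed
  ultimately show ?thesis by (simp add: centralizer_O_def)
qed

text \<open>On the unit circle the rotated sum is x A + y B up to a constant. Its maximum is the
  length r of (A, B), attained at (A/r, B/r), so a maximum at (1, 0) forces B = 0.\<close>

lemma rot_maximal:
  assumes ij: "i \<noteq> j"
    and max: "\<And>x y. x\<^sup>2 + y\<^sup>2 = 1 \<Longrightarrow>
      (\<Sum>p\<in>UNIV. c p * (rot i j x y ** N) $ p $ p) \<le> (\<Sum>p\<in>UNIV. c p * N $ p $ p)"
  shows "c j * N $ i $ j = c i * N $ j $ i"
proof -
  define A where "A = c i * N $ i $ i + c j * N $ j $ j"
  define B where "B = c j * N $ i $ j - c i * N $ j $ i"
  have le: "x * A + y * B \<le> A" if "x\<^sup>2 + y\<^sup>2 = 1" for x y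
  proof -
    have "(\<Sum>p\<in>UNIV. c p * (rot i j x y ** N) $ p $ p) = (\<Sum>p\<in>UNIV. c p * N $ p $ p
      + (if p = i then c i * (x * N $ i $ i - y * N $ j $ i - N $ i $ i) else 0)
      + (if p = j then c j * (y * N $ i $ j + x * N $ j $ j - N $ j $ j) else 0))"
      unfolding rot_mult[OF ij] using ij by (intro sum.cong refl) (auto simp: algebra_simps)
    then show ?thesis
      using max[OF that] by (simp add: sum.distrib A_def B_def algebra_simps)
  qed
  define r where "r = sqrt (A\<^sup>2 + B\<^sup>2)"
  have r2: "r\<^sup>2 = A\<^sup>2 + B\<^sup>2" by (simp add: r_def)
  have "B = 0"
  proof (rule ccontr)
    assume "B \<noteq> 0"
    then have r0: "r > 0" "\<bar>A\<bar> < r"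
      by (auto simp: r_def sum_power2_gt_zero_iff real_less_rsqrt)
    have "(A / r)\<^sup>2 + (B / r)\<^sup>2 = 1"
      using r0 unfolding power_divide add_divide_distrib[symmetric] r2[symmetric] by simp
    from le[OF this] have "(A\<^sup>2 + B\<^sup>2) / r \<le> A"
      by (simp add: power2_eq_square add_divide_distrib)
    then have "r \<le> A"
      unfolding r2[symmetric] using r0 by (simp add: power2_eq_square)
    then show False using r0 by simp
  qed
  then show ?thesis by (simp add: B_def)
qed

text \<open>With \<open>c\<close> positive and injective, a maximizer of \<open>tr (diag_mat c k h l)\<close> over orthogonal \<open>k\<close>, \<open>l\<close>
  makes \<open>k h l\<close> diagonal: stationarity under plane rotations on either side gives
  \<open>c\<^sub>j M\<^sub>i\<^sub>j = c\<^sub>i M\<^sub>j\<^sub>i\<close> and \<open>c\<^sub>i M\<^sub>i\<^sub>j = c\<^sub>j M\<^sub>j\<^sub>i\<close>.\<close>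

lemma svd_centralizer:
  fixes h :: "'n::finite matr"
  assumes h: "h ** diag_mat b = diag_mat b ** h"
  obtains k l a where "k \<in> centralizer_O b" "l \<in> centralizer_O b" "k ** h ** l = diag_mat a"
proof -
  obtain e :: "'n \<Rightarrow> nat" where e: "inj e"
    using finite_imp_inj_to_nat_seg[of "UNIV :: 'n set"] by auto
  \<comment> \<open>The shift by 1 keeps the value 0 of the injection from spoiling
    positivity.\<close>
  define c where "c i = real (e i) + 1" for i
  have c: "c i > 0" "c i = c j \<Longrightarrow> i = j" for i j
    using e by (auto simp: c_def inj_def)
  let ?K = "centralizer_O b"
  let ?f = "\<lambda>z. \<Sum>p\<in>UNIV. c p * (fst z ** h ** snd z) $ p $ p"
  have "continuous_on (?K \<times> ?K) ?f"
    unfolding matrix_matrix_mult_def vec_lambda_beta by (intro continuous_intros)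
  moreover have "compact (?K \<times> ?K)" by (intro compact_Times compact_centralizer_O)
  moreover have "?K \<times> ?K \<noteq> {}" using centralizer_O_one by blast
  ultimately obtain z where z: "z \<in> ?K \<times> ?K" "\<forall>w\<in>?K \<times> ?K. ?f w \<le> ?f z"
    using continuous_attains_sup by meson
  define k l where "k = fst z" and "l = snd z"
  have k: "k \<in> ?K" and l: "l \<in> ?K" using z(1) by (auto simp: k_def l_def)
  have max: "(\<Sum>p\<in>UNIV. c p * (k' ** h ** l') $ p $ p) \<le> (\<Sum>p\<in>UNIV. c p * (k ** h ** l) $ p $ p)"
    if "k' \<in> ?K" "l' \<in> ?K" for k' l'
    using bspec[OF z(2), of "(k', l')"] that by (simp add: k_def l_def)
  define M where "M = k ** h ** l"
  have comm: "M $ i $ j \<noteq> 0 \<Longrightarrow> b i = b j" for i j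
  proof -
    have "M ** diag_mat b = diag_mat b ** M"
      using k l h unfolding M_def centralizer_O_def by (simp add: matrix_mul_assoc) (metis matrix_mul_assoc)
    then show "M $ i $ j \<noteq> 0 \<Longrightarrow> b i = b j" for i j by (simp add: commute_diag_mat_iff)
  qed
  have "M $ i $ j = 0" if ij: "i \<noteq> j" for i j
  proof (rule ccontr)
    assume nz: "M $ i $ j \<noteq> 0"
    \<comment> \<open>Rotations in the plane of i and j thus lie in the centralizer and are
      admissible variations.\<close>
    have bij: "b i = b j" by (rule comm[OF nz])
    have "c j * M $ i $ j = c i * M $ j $ i"
    proof (rule rot_maximal[OF ij])
      fix x y :: real assume "x\<^sup>2 + y\<^sup>2 = 1"
      then have "rot i j x y ** k \<in> ?K"
        by (intro centralizer_O_mult rot_centralizer_O ij bij k)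
      from max[OF this l] show "(\<Sum>p\<in>UNIV. c p * (rot i j x y ** M) $ p $ p) \<le> (\<Sum>p\<in>UNIV. c p * M $ p $ p)"
        by (simp add: M_def matrix_mul_assoc)
    qed
    \<comment> \<open>Rotating on the right is rotating the transpose on the left.\<close>
    moreover have "c j * transpose M $ i $ j = c i * transpose M $ j $ i"
    proof (rule rot_maximal[OF ij])
      fix x y :: real assume "x\<^sup>2 + y\<^sup>2 = 1"
      then have "l ** transpose (rot i j x y) \<in> ?K"
        by (intro centralizer_O_mult centralizer_O_transpose rot_centralizer_O ij bij l)
      from max[OF k this] have "(\<Sum>p\<in>UNIV. c p * (M ** transpose (rot i j x y)) $ p $ p) \<le> (\<Sum>p\<in>UNIV. c p * M $ p $ p)"
        by (simp add: M_def matrix_mul_assoc)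
      moreover have "(rot i j x y ** transpose M) $ p $ p = (M ** transpose (rot i j x y)) $ p $ p" for p
        by (simp add: matrix_matrix_mult_def transpose_def mult.commute)
      ultimately show "(\<Sum>p\<in>UNIV. c p * (rot i j x y ** transpose M) $ p $ p)
          \<le> (\<Sum>p\<in>UNIV. c p * transpose M $ p $ p)"
        by (simp add: transpose_def[of M])
    qed
    then have "c j * M $ j $ i = c i * M $ i $ j" by (simp add: transpose_def)
    ultimately have "c j * c j * M $ i $ j = c i * c i * M $ i $ j"
      by (metis mult.assoc mult.left_commute)
    then have "c j * c j = c i * c i" using nz by simp
    then have "c j = c i" using c(1)[of i] c(1)[of j] by (metis less_imp_le real_sqrt_abs2 abs_of_nonneg)
    then show False using c(2) ij by metis
  qed
  then have "M = diag_mat (\<lambda>i. M $ i $ i)" by (simp add: vec_eq_iff)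
  then show thesis using that[OF k l] unfolding M_def by blast
qed

section \<open>Vectors of the stratum are semistable\<close>

text \<open>Otherwise the weight hull, and with it \<beta>, would lie in the open half-space where A
  is negative, although A is orthogonal to \<beta>.\<close>

lemma exists_nonneg_weight:
  fixes x :: "'n::{finite,linorder} bilin"
  assumes "x \<in> V" "x \<noteq> 0" "beta_of x = diag_mat b" "(\<Sum>i\<in>UNIV. A i * b i) = 0"
  shows "\<exists>i j k. coef x i j k \<noteq> 0 \<and> 0 \<le> A k - A i - A j"
proof (rule ccontr)
  assume "\<not> ?thesis"
  then have "weights x \<subseteq> {w. inner (diag_mat A) w < 0}"
    unfolding weights_eq[OF assms(1)] by (clarsimp simp: inner_weight not_le) (metis)
  then have "convex hull weights x \<subseteq> {w. inner (diag_mat A) w < 0}"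
    by (rule hull_minimal) (rule convex_halfspace_lt)
  then have "inner (diag_mat A) (diag_mat b) < 0"
    using beta_of_in_hull[OF assms(1,2)] assms(3) by auto
  then show False using assms(4) by (simp add: inner_diag_mat_right)
qed

text \<open>A enters only through the set of triples it selects, and there are finitely many such
  sets. For each, the sum is continuous and positive on a compact group, so it has a positive
  minimum; the least of these works for all A.\<close>

lemma stratum_uniform_lower_bound:
  fixes \<mu> :: "'n::{finite,linorder} bilin"
  assumes \<mu>: "\<mu> \<in> W_beta (diag_mat b)" and S: "\<mu> \<in> S_beta (diag_mat b)"
  obtains c where "c > 0"
    "\<And>k A. k \<in> centralizer_O b \<Longrightarrow> (\<Sum>i\<in>UNIV. A i * b i) = 0 \<Longrightarrow>
      c \<le> (\<Sum>(i, j, l)\<in>{(i, j, l). 0 \<le> A l - A i - A j}. \<bar>coef (act k \<mu>) i j l\<bar>)"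
proof -
  let ?K = "centralizer_O b"
  let ?E = "\<lambda>A. {(i, j, l). 0 \<le> A l - A i - A j} :: ('n \<times> 'n \<times> 'n) set"
  let ?f = "\<lambda>E k. \<Sum>(i, j, l)\<in>E. \<bar>coef (act k \<mu>) i j l\<bar>"
  have \<mu>0: "\<mu> \<in> V" "\<mu> \<noteq> 0" using S by (auto simp: S_beta_def)
  \<comment> \<open>k lies in the parabolic subgroup of b, so \<open>act k \<mu>\<close> stays in
    \<open>W_beta\<close>; the norm bound from \<open>S_beta\<close> then identifies its
    \<open>beta_of\<close>.\<close>
  have beta: "act k \<mu> \<in> V" "act k \<mu> \<noteq> 0" "beta_of (act k \<mu>) = diag_mat b" if k: "k \<in> ?K" for k
  proof -
    have i: "orthogonal_matrix k" "invertible k" "k ** diag_mat b = diag_mat b ** k"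
      using k orthogonal_matrix_inv(2) by (auto simp: centralizer_O_def)
    show "act k \<mu> \<in> V" using \<mu>0 by (simp add: act_in_V)
    show n0: "act k \<mu> \<noteq> 0"
      using norm_act_orthogonal[OF i(1), of \<mu>] \<mu>0 by auto
    have "norm (beta_of (act k \<mu>)) \<le> norm (diag_mat b)"
      using S i(2) by (auto simp: S_beta_def GL_def)
    then show "beta_of (act k \<mu>) = diag_mat b"
      by (intro beta_of_eqI W_beta_act \<mu> commute_in_parabolic i n0)
  qed
  have cont: "continuous_on ?K (?f E)" for E
  proof -
    have "continuous_on ?K (\<lambda>k. coef (act k \<mu>) i j l)" for i j l
    proof -
      \<comment> \<open>On this group the inverse is the transpose, so the coefficients are
        polynomial in k.\<close>
      have "continuous_on ?K (\<lambda>k. \<Sum>c\<in>UNIV. \<Sum>a\<in>UNIV. \<Sum>d\<in>UNIV.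
          k $ l $ c * (k $ i $ a * k $ j $ d * coef \<mu> a d c))"
        by (intro continuous_intros)
      then show ?thesis
        by (rule continuous_on_eq)
          (simp add: coef_act centralizer_O_def orthogonal_matrix_inv transpose_def)
    qed
    then show ?thesis
      unfolding case_prod_unfold by (intro continuous_intros)
  qed
  have "\<forall>E. \<exists>c. c > 0 \<and> ((\<exists>A. E = ?E A \<and> (\<Sum>i\<in>UNIV. A i * b i) = 0) \<longrightarrow> (\<forall>k\<in>?K. c \<le> ?f E k))"
  proof
    fix E
    show "\<exists>c. c > 0 \<and> ((\<exists>A. E = ?E A \<and> (\<Sum>i\<in>UNIV. A i * b i) = 0) \<longrightarrow> (\<forall>k\<in>?K. c \<le> ?f E k))"
    proof (cases "\<exists>A. E = ?E A \<and> (\<Sum>i\<in>UNIV. A i * b i) = 0")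
      case True
      then obtain A where A: "E = ?E A" "(\<Sum>i\<in>UNIV. A i * b i) = 0" by blast
      obtain k where k: "k \<in> ?K" "\<forall>l\<in>?K. ?f E k \<le> ?f E l"
        using continuous_attains_inf[OF compact_centralizer_O _ cont] centralizer_O_one by blast
      obtain i j l where "coef (act k \<mu>) i j l \<noteq> 0" "(i, j, l) \<in> E"
        using exists_nonneg_weight[OF beta[OF k(1)] A(2)] A(1) by auto
      then have "?f E k > 0"
        by (intro sum_pos2[of E "(i, j, l)"]) auto
      then show ?thesis using k(2) by blast
    next
      case False
      \<comment> \<open>Sets selected by no A get the default 1, so that c is positive everywhere
        and the final minimum is too.\<close>
      show ?thesis by (rule exI[of _ "1::real"], rule conjI, rule zero_less_one, rule impI, erule notE[OF False])
    qed
  qed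
  from choice[OF this] obtain c where
    "\<forall>E. c E > 0 \<and> ((\<exists>A. E = ?E A \<and> (\<Sum>i\<in>UNIV. A i * b i) = 0) \<longrightarrow> (\<forall>k\<in>?K. c E \<le> ?f E k))" ..
  then have c: "c E > 0"
    "E = ?E A \<Longrightarrow> (\<Sum>i\<in>UNIV. A i * b i) = 0 \<Longrightarrow> k \<in> ?K \<Longrightarrow> c E \<le> ?f E k" for E A k
    by blast+
  show thesis
  proof (rule that[of "Min (range c)"])
    show "Min (range c) > 0" using c(1) by (simp add: Min_gr_iff)
    show "Min (range c) \<le> ?f (?E A) k" if "k \<in> ?K" "(\<Sum>i\<in>UNIV. A i * b i) = 0" for k A
    proof -
      have "Min (range c) \<le> c (?E A)" by (rule Min_le) auto
      also have "\<dots> \<le> ?f (?E A) k" by (rule c(2)[OF refl that(2,1)])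
      finally show ?thesis .
    qed
  qed
qed

lemma stratum_imp_semistable:
  fixes \<mu> :: "'n::{finite,linorder} bilin"
  assumes \<mu>: "\<mu> \<in> W_beta (diag_mat b)" and S: "\<mu> \<in> S_beta (diag_mat b)"
  shows "semistable (H_beta (diag_mat b)) \<mu>"
proof -
  obtain c where c: "c > 0"
    "\<And>k A. k \<in> centralizer_O b \<Longrightarrow> (\<Sum>i\<in>UNIV. A i * b i) = 0 \<Longrightarrow>
      c \<le> (\<Sum>(i, j, l)\<in>{(i, j, l). 0 \<le> A l - A i - A j}. \<bar>coef (act k \<mu>) i j l\<bar>)"
    by (rule stratum_uniform_lower_bound[OF \<mu> S]) (rule that)
  define N where "N = real (CARD('n \<times> 'n \<times> 'n))"
  have N: "N > 0" by (simp add: N_def)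
  have "c / N \<le> norm (act h \<mu>)" if hH: "h \<in> H_beta (diag_mat b)" for h
  proof -
    note h = H_beta_props[OF hH]
    obtain k l a where k: "k \<in> centralizer_O b" and l: "l \<in> centralizer_O b"
      and kl: "k ** h ** l = diag_mat a"
      by (rule svd_centralizer[OF h(2)])
    have O: "orthogonal_matrix k" "orthogonal_matrix l" "k ** diag_mat b = diag_mat b ** k"
      "l ** diag_mat b = diag_mat b ** l"
      using k l by (auto simp: centralizer_O_def)
    have I: "invertible k" "invertible l" "invertible (transpose l)"
      using O(1,2) orthogonal_matrix_inv(2) orthogonal_matrix_transpose by blast+
    have "invertible (diag_mat a)"
      unfolding kl[symmetric] by (intro invertible_mult I h)
    then have "(\<Prod>i\<in>UNIV. a i) \<noteq> 0"
      by (simp add: invertible_det_nz det_diagonal)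
    then have a: "a i \<noteq> 0" for i by simp
    define A where "A i = ln \<bar>a i\<bar>" for i
    have "log_char b (k ** h ** l) = log_char b k + log_char b h + log_char b l"
    proof -
      have "k ** h ** diag_mat b = diag_mat b ** (k ** h)"
        by (metis O(3) h(2) matrix_mul_assoc)
      then show ?thesis
        by (simp add: log_char_mult I h O invertible_mult)
    qed
    \<comment> \<open>k, h and l all have \<open>log_char\<close> 0, so the vector of logarithms is
      orthogonal to \<beta>. Absolute values appear because the a i may be negative.\<close>
    then have "(\<Sum>i\<in>UNIV. b i * ln \<bar>a i\<bar>) = 0"
      unfolding kl log_char_diag_mat[OF a] using O h(3) by (simp add: log_char_orthogonal)
    then have A0: "(\<Sum>i\<in>UNIV. A i * b i) = 0" by (simp add: A_def mult.commute)
    let ?x = "act (transpose l) \<mu>"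
    have "k ** h = diag_mat a ** transpose l"
      unfolding kl[symmetric] using O(2)
      by (simp add: matrix_mul_assoc[symmetric] orthogonal_matrix_def)
    then have "act k (act h \<mu>) = act (diag_mat a) ?x"
      using \<open>invertible (diag_mat a)\<close> I h(1) by (metis act_mult)
    then have n: "norm (act h \<mu>) = norm (act (diag_mat a) ?x)"
      using norm_act_orthogonal[OF O(1), of "act h \<mu>"] by simp
    let ?E = "{(i, j, l). 0 \<le> A l - A i - A j}"
    have "c \<le> (\<Sum>(i, j, l)\<in>?E. \<bar>coef ?x i j l\<bar>)"
      by (intro c(2) A0 centralizer_O_transpose l)
    \<comment> \<open>On the selected triples the diagonal factor has absolute value at least 1, so
      it does not shrink these coefficients.\<close>
    also have "\<dots> \<le> (\<Sum>(i, j, l)\<in>?E. norm (act h \<mu>))"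
    proof (rule sum_mono, clarify)
      fix i j l assume nonneg: "0 \<le> A l - A i - A j"
      have "\<bar>a l / (a i * a j)\<bar> = exp (A l - A i - A j)"
        using a by (simp add: A_def exp_diff abs_mult)
      then have "1 \<le> \<bar>a l / (a i * a j)\<bar>" using nonneg by simp
      then have "1 * \<bar>coef ?x i j l\<bar> \<le> \<bar>a l / (a i * a j)\<bar> * \<bar>coef ?x i j l\<bar>"
        by (rule mult_right_mono) simp
      also have "\<dots> = \<bar>coef (act (diag_mat a) ?x) i j l\<bar>"
        by (simp add: coef_act_diag_mat[OF a] abs_mult)
      also have "\<dots> \<le> norm (act h \<mu>)" unfolding n by (rule abs_coef_le_norm)
      finally show "\<bar>coef ?x i j l\<bar> \<le> norm (act h \<mu>)" by simp
    qed
    also have "\<dots> = real (card ?E) * norm (act h \<mu>)" by (simp add: case_prod_unfold)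
    also have "\<dots> \<le> N * norm (act h \<mu>)"
      unfolding N_def by (intro mult_right_mono of_nat_mono card_mono) auto
    finally show ?thesis using N by (simp add: field_simps)
  qed
  then show ?thesis
    unfolding semistable_iff using c(1) N by (intro exI[of _ "c / N"]) auto
qed

theorem proposition2p14:
  fixes \<beta> :: "real^'n::{finite,linorder}^'n::{finite,linorder}"
  assumes "\<beta> \<in> diagonal"
    and "S_beta \<beta> \<noteq> {}"
  shows "Zss_beta \<beta> = {\<mu> \<in> Z_beta \<beta>. semistable (H_beta \<beta>) \<mu>}
    \<and> Yss_beta \<beta> = {\<mu> \<in> W_beta \<beta>. semistable (H_beta \<beta>) \<mu>}"
proof -
  define b where "b i = \<beta> $ i $ i" for i
  have \<beta>: "\<beta> = diag_mat b"
    unfolding b_def[abs_def] by (rule diagonal_eq_diag_mat[OF assms(1)])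
  have "(\<Sum>i\<in>UNIV. b i) = - 1"
    using trace_eq_if_S_beta_nonempty[OF assms(2)] unfolding \<beta> inner_diag_mat_right by (simp add: mat_def)
  then have "semistable (H_beta \<beta>) \<mu> \<longleftrightarrow> \<mu> \<in> Y_beta \<beta> \<inter> S_beta \<beta>" if "\<mu> \<in> W_beta \<beta>" for \<mu>
    using that semistable_in_Y_S stratum_imp_semistable unfolding \<beta> by blast
  \<comment> \<open>Since \<open>Z_beta \<beta>\<close> lies in \<open>W_beta \<beta>\<close>, this
    puts \<open>Zss_beta \<beta>\<close> inside \<open>Y_beta \<beta>\<close>, where the equivalence
    yields (i).\<close>
  moreover have "\<mu> \<in> Y_beta \<beta>" if "\<mu> \<in> W_beta \<beta> \<inter> S_beta \<beta>" for \<mu>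
    using that semistable_in_Y_S stratum_imp_semistable \<open>(\<Sum>i\<in>UNIV. b i) = - 1\<close> unfolding \<beta> by blast
  moreover have "Y_beta \<beta> \<subseteq> W_beta \<beta>" by (auto simp: Y_beta_def)
  ultimately show ?thesis
    using Z_beta_subset_W_beta[of \<beta>] unfolding Zss_beta_def Yss_beta_def by blast
qed

end
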